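(* Let $\mathcal{O}$ be a Euclidean oriented matroid on ground set $E$ and let $\mathcal{O}\cup p$ be a lexicographic extension of $\mathcal{O}$. Then for every $f\in E$ such that $(\mathcal{O}\cup p,p,f)$ is an oriented matroid program, $(\mathcal{O}\cup p,p,f)$ is a Euclidean oriented matroid program.
   Context: An oriented matroid $\mathcal{O}$ on a finite ground set $E$ is given by its set of covectors in $\{+,-,0\}^E$; cocircuits are the minimal nonzero covectors. For a sign vector $X$, $X_e$ is its $e$-entry, $\mathrm{supp}(X)=\{e:X_e\neq 0\}$, $z(X)=E\setminus \mathrm{supp}(X)$, $(X\circ Y)_e=X_e$ if $X_e\ne0$ and $Y_e$ otherwise, $\mathrm{sep}(X,Y)=\{e: X_e=-Y_e\neq 0\}$; $X,Y$ are conformal if $\mathrm{sep}(X,Y)=\emptyset$. Let $r$ be the rank of the underlying matroid $\mathcal{M}(\mathcal{O})$. Two cocircuits $X\neq\pm Y$ are comodular if $z(X),z(Y)$ form a modular pair in $\mathcal{M}(\mathcal{O})$, equivalently $z(X\circ Y)$ is a flat of rank $r-2$. For comodular $X,Y$ and $e\in\mathrm{sep}(X,Y)$, cocircuit elimination of $e$ between $X$ and $Y$ yields the unique cocircuit $Z$ with $Z_e=0$ and $\mathrm{supp}(Z)\subseteq \mathrm{supp}(X\circ Y)\setminus\{e\}$. An oriented matroid program $(\mathcal{O},g,f)$ consists of $\mathcal{O}$ and distinct $g,f\in E$ with $g$ not a loop and $f$ not a coloop. For comodular cocircuits $X,Y$ with $X_g=Y_g\neq0$ let $Z$ be obtained by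 elimination of $g$ between $-X$ and $Y$; write $X\to Y$ if $Z_f=+$, $X\leftarrow Y$ if $Z_f=-$, and $X\leftrightarrow Y$ (undirected) if $Z_f=0$. The graph $G_f$ of $(\mathcal{O},g,f)$ has as vertices the cocircuits $Y$ with $Y_g=+$, and an edge between any two conformal comodular cocircuits, directed as just described. A directed cycle in $G_f$ is a sequence $P^1,\dots,P^n=P^1$ with $P^1,\dots,P^{n-1}$ pairwise distinct, consecutive entries adjacent, $P^i\to P^{i+1}$ or $P^i\leftrightarrow P^{i+1}$ for all $i$, and not all edges undirected. $(\mathcal{O},g,f)$ is Euclidean if $G_f$ has no directed cycle; $\mathcal{O}$ is Euclidean if every program $(\mathcal{O},g,f)$ ($g\neq f$, $g$ not a loop, $f$ not a coloop) is Euclidean. For an ordered subset $I=[e_1,\dots,e_k]$ of $E$ and $\alpha\in\{+,-\}^k$, the lexicographic extension $\mathcal{O}[e_1^{\alpha_1},\dots,e_k^{\alpha_k}]=\mathcal{O}\cup p$ is the single-element extension by a new element $p$ with localization $\sigma(Y)=\alpha_iY_{e_i}$ on cocircuits $Y$, where $i$ is the smallest index with $Y_{e_i}\neq 0$, and $\sigma(Y)=0$ if $Y_{e_1}=\dots=Y_{e_k}=0$. *)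

theory Defs
  imports Main
begin

text \<open>A sign vector on a ground set \<open>E :: 'a set\<close> is a function with values in
  \<open>{-1, 0, 1}\<close> that vanishes outside \<open>E\<close>, so that equality of functions is equality
  of sign vectors and \<open>- X\<close> is the pointwise negation.\<close>

type_synonym 'a sign_vec = "'a \<Rightarrow> int"

definition sign_vectors :: "'a set \<Rightarrow> 'a sign_vec set" where
  "sign_vectors E = {X. (\<forall>e\<in>E. X e \<in> {-1, 0, 1}) \<and> (\<forall>e. e \<notin> E \<longrightarrow> X e = 0)}"

definition supp :: "'a sign_vec \<Rightarrow> 'a set" where
  "supp X = {e. X e \<noteq> 0}"

definition zero_set :: "'a set \<Rightarrow> 'a sign_vec \<Rightarrow> 'a set" where
  "zero_set E X = E - supp X"

definition sv_comp :: "'a sign_vec \<Rightarrow> 'a sign_vec \<Rightarrow> 'a sign_vec" where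
  "sv_comp X Y = (\<lambda>e. if X e \<noteq> 0 then X e else Y e)"

definition sep :: "'a sign_vec \<Rightarrow> 'a sign_vec \<Rightarrow> 'a set" where
  "sep X Y = {e. X e = - Y e \<and> X e \<noteq> 0}"

definition conformal :: "'a sign_vec \<Rightarrow> 'a sign_vec \<Rightarrow> bool" where
  "conformal X Y \<longleftrightarrow> sep X Y = {}"

text \<open>The covector axioms; \<open>L\<close> is the set of covectors.\<close>

definition oriented_matroid :: "'a set \<Rightarrow> 'a sign_vec set \<Rightarrow> bool" where
  "oriented_matroid E L \<longleftrightarrow>
     finite E \<and> L \<subseteq> sign_vectors E \<and>
     (\<lambda>_. 0) \<in> L \<and>
     (\<forall>X\<in>L. - X \<in> L) \<and>
     (\<forall>X\<in>L. \<forall>Y\<in>L. sv_comp X Y \<in> L) \<and>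
     (\<forall>X\<in>L. \<forall>Y\<in>L. \<forall>e\<in>sep X Y. \<exists>Z\<in>L. Z e = 0 \<and>
        (\<forall>h\<in>E - sep X Y. Z h = sv_comp X Y h))"

text \<open>The order on sign vectors induced componentwise by \<open>0 < +\<close> and \<open>0 < -\<close>.\<close>

definition face_le :: "'a sign_vec \<Rightarrow> 'a sign_vec \<Rightarrow> bool" where
  "face_le X Y \<longleftrightarrow> (\<forall>e. X e = 0 \<or> X e = Y e)"

definition cocircuits :: "'a sign_vec set \<Rightarrow> 'a sign_vec set" where
  "cocircuits L = {X \<in> L. X \<noteq> (\<lambda>_. 0) \<and>
     (\<forall>Y\<in>L. Y \<noteq> (\<lambda>_. 0) \<and> face_le Y X \<longrightarrow> Y = X)}"

text \<open>The underlying matroid is the matroid on \<open>E\<close> whose flats are the zero sets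
  of the covectors.\<close>

definition flats :: "'a set \<Rightarrow> 'a sign_vec set \<Rightarrow> 'a set set" where
  "flats E L = zero_set E ` L"

definition mat_closure :: "'a set \<Rightarrow> 'a sign_vec set \<Rightarrow> 'a set \<Rightarrow> 'a set" where
  "mat_closure E L A = \<Inter> {F \<in> flats E L. A \<subseteq> F}"

definition mat_indep :: "'a set \<Rightarrow> 'a sign_vec set \<Rightarrow> 'a set \<Rightarrow> bool" where
  "mat_indep E L A \<longleftrightarrow> A \<subseteq> E \<and> (\<forall>e\<in>A. e \<notin> mat_closure E L (A - {e}))"

definition mat_basis :: "'a set \<Rightarrow> 'a sign_vec set \<Rightarrow> 'a set \<Rightarrow> bool" where
  "mat_basis E L B \<longleftrightarrow> mat_indep E L B \<and> (\<forall>A. mat_indep E L A \<and> B \<subseteq> A \<longrightarrow> A = B)"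

definition mat_rank :: "'a set \<Rightarrow> 'a sign_vec set \<Rightarrow> 'a set \<Rightarrow> nat" where
  "mat_rank E L A = Max (card ` {B. B \<subseteq> A \<and> mat_indep E L B})"

definition mat_loop :: "'a set \<Rightarrow> 'a sign_vec set \<Rightarrow> 'a \<Rightarrow> bool" where
  "mat_loop E L e \<longleftrightarrow> e \<in> E \<and> \<not> mat_indep E L {e}"

definition mat_coloop :: "'a set \<Rightarrow> 'a sign_vec set \<Rightarrow> 'a \<Rightarrow> bool" where
  "mat_coloop E L e \<longleftrightarrow> e \<in> E \<and> (\<forall>B. mat_basis E L B \<longrightarrow> e \<in> B)"

definition modular_pair :: "'a set \<Rightarrow> 'a sign_vec set \<Rightarrow> 'a set \<Rightarrow> 'a set \<Rightarrow> bool" where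
  "modular_pair E L A B \<longleftrightarrow>
     mat_rank E L A + mat_rank E L B = mat_rank E L (A \<union> B) + mat_rank E L (A \<inter> B)"

definition comodular :: "'a set \<Rightarrow> 'a sign_vec set \<Rightarrow> 'a sign_vec \<Rightarrow> 'a sign_vec \<Rightarrow> bool" where
  "comodular E L X Y \<longleftrightarrow>
     X \<in> cocircuits L \<and> Y \<in> cocircuits L \<and> X \<noteq> Y \<and> X \<noteq> - Y \<and>
     modular_pair E L (zero_set E X) (zero_set E Y)"

text \<open>Cocircuit elimination of \<open>e\<close> between comodular \<open>X\<close> and \<open>Y\<close>. The conditions
  \<open>Z e = 0\<close> and \<open>supp Z \<subseteq> supp (sv_comp X Y) - {e}\<close> alone determine \<open>Z\<close> only up to sign;
  the sign is fixed by the usual requirement of the elimination axiom that the positive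
  (negative) part of \<open>Z\<close> is contained in the union of the positive (negative) parts of
  \<open>X\<close> and \<open>Y\<close>, that is, every nonzero entry of \<open>Z\<close> agrees with \<open>X\<close> or with \<open>Y\<close>.\<close>

definition cocircuit_elim ::
  "'a sign_vec set \<Rightarrow> 'a \<Rightarrow> 'a sign_vec \<Rightarrow> 'a sign_vec \<Rightarrow> 'a sign_vec" where
  "cocircuit_elim L e X Y = (THE Z. Z \<in> cocircuits L \<and> Z e = 0 \<and>
     supp Z \<subseteq> supp (sv_comp X Y) - {e} \<and>
     (\<forall>h\<in>supp Z. Z h = X h \<or> Z h = Y h))"

definition om_program :: "'a set \<Rightarrow> 'a sign_vec set \<Rightarrow> 'a \<Rightarrow> 'a \<Rightarrow> bool" where
  "om_program E L g f \<longleftrightarrow>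
     oriented_matroid E L \<and> g \<in> E \<and> f \<in> E \<and> g \<noteq> f \<and>
     \<not> mat_loop E L g \<and> \<not> mat_coloop E L f"

definition graph_verts :: "'a sign_vec set \<Rightarrow> 'a \<Rightarrow> 'a sign_vec set" where
  "graph_verts L g = {Y \<in> cocircuits L. Y g = 1}"

definition graph_adj ::
  "'a set \<Rightarrow> 'a sign_vec set \<Rightarrow> 'a \<Rightarrow> 'a sign_vec \<Rightarrow> 'a sign_vec \<Rightarrow> bool" where
  "graph_adj E L g X Y \<longleftrightarrow>
     X \<in> graph_verts L g \<and> Y \<in> graph_verts L g \<and> conformal X Y \<and> comodular E L X Y"

definition edge_fwd ::
  "'a sign_vec set \<Rightarrow> 'a \<Rightarrow> 'a \<Rightarrow> 'a sign_vec \<Rightarrow> 'a sign_vec \<Rightarrow> bool" where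
  "edge_fwd L g f X Y \<longleftrightarrow> cocircuit_elim L g (- X) Y f = 1"

definition edge_undirected ::
  "'a sign_vec set \<Rightarrow> 'a \<Rightarrow> 'a \<Rightarrow> 'a sign_vec \<Rightarrow> 'a sign_vec \<Rightarrow> bool" where
  "edge_undirected L g f X Y \<longleftrightarrow> cocircuit_elim L g (- X) Y f = 0"

definition directed_cycle ::
  "'a set \<Rightarrow> 'a sign_vec set \<Rightarrow> 'a \<Rightarrow> 'a \<Rightarrow> 'a sign_vec list \<Rightarrow> bool" where
  "directed_cycle E L g f Ps \<longleftrightarrow>
     Ps \<noteq> [] \<and> set Ps \<subseteq> graph_verts L g \<and> last Ps = hd Ps \<and> distinct (butlast Ps) \<and>
     (\<forall>i. Suc i < length Ps \<longrightarrow> graph_adj E L g (Ps ! i) (Ps ! Suc i) \<and>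
        (edge_fwd L g f (Ps ! i) (Ps ! Suc i) \<or> edge_undirected L g f (Ps ! i) (Ps ! Suc i))) \<and>
     \<not> (\<forall>i. Suc i < length Ps \<longrightarrow> edge_undirected L g f (Ps ! i) (Ps ! Suc i))"

definition euclidean_program :: "'a set \<Rightarrow> 'a sign_vec set \<Rightarrow> 'a \<Rightarrow> 'a \<Rightarrow> bool" where
  "euclidean_program E L g f \<longleftrightarrow>
     om_program E L g f \<and> (\<nexists>Ps. directed_cycle E L g f Ps)"

definition euclidean_om :: "'a set \<Rightarrow> 'a sign_vec set \<Rightarrow> bool" where
  "euclidean_om E L \<longleftrightarrow>
     oriented_matroid E L \<and>
     (\<forall>g f. om_program E L g f \<longrightarrow> euclidean_program E L g f)"

text \<open>\<open>(insert p E, L')\<close> is the single-element extension of \<open>(E, L)\<close> by \<open>p\<close> with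
  localization \<open>\<sigma>\<close>: deleting \<open>p\<close> gives \<open>(E, L)\<close>, and each cocircuit \<open>Y\<close> of \<open>(E, L)\<close>
  extends to the cocircuit \<open>(Y, \<sigma> Y)\<close>. As usual, extensions preserve the rank; without this
  requirement the localization \<open>\<sigma> = 0\<close> would not distinguish adding \<open>p\<close> as a loop from
  adding it as a coloop.\<close>

definition single_element_extension ::
  "'a set \<Rightarrow> 'a sign_vec set \<Rightarrow> 'a \<Rightarrow> ('a sign_vec \<Rightarrow> int) \<Rightarrow> 'a sign_vec set \<Rightarrow> bool" where
  "single_element_extension E L p \<sigma> L' \<longleftrightarrow>
     p \<notin> E \<and> oriented_matroid (insert p E) L' \<and>
     (\<lambda>X. X(p := 0)) ` L' = L \<and>
     mat_rank (insert p E) L' (insert p E) = mat_rank E L E \<and>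
     (\<forall>Y\<in>cocircuits L. Y(p := \<sigma> Y) \<in> cocircuits L')"

text \<open>A signed ordered subset is encoded as the list of the pairs \<open>(e\<^sub>i, \<alpha>\<^sub>i)\<close>.\<close>

fun lex_localization :: "('a \<times> int) list \<Rightarrow> 'a sign_vec \<Rightarrow> int" where
  "lex_localization [] Y = 0"
| "lex_localization ((e, \<alpha>) # I) Y = (if Y e \<noteq> 0 then \<alpha> * Y e else lex_localization I Y)"

definition lexicographic_extension ::
  "'a set \<Rightarrow> 'a sign_vec set \<Rightarrow> ('a \<times> int) list \<Rightarrow> 'a \<Rightarrow> 'a sign_vec set \<Rightarrow> bool" where
  "lexicographic_extension E L I p L' \<longleftrightarrow>
     distinct (map fst I) \<and> fst ` set I \<subseteq> E \<and> snd ` set I \<subseteq> {1, -1} \<and>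
     single_element_extension E L p (lex_localization I) L'"

end

theory Submission
  imports Defs
begin

text \<open>Let \<open>p\<close> extend a Euclidean oriented matroid by the list \<open>[e\<^sub>1, \<dots>, e\<^sub>k]\<close>, and suppose the graph of the
  program \<open>(p, f)\<close> has a directed cycle. Signs of \<open>f\<close> never decrease along edges, so \<open>f\<close> has a constant
  sign \<open>c\<close> on the cycle, and \<open>c = 0\<close> would make all edges undirected. Let \<open>e\<close> be the first list element
  that does not vanish on the whole cycle. All edges between \<open>e = 0\<close> and \<open>e \<noteq> 0\<close> are directed the
  same way, which is determined by \<open>c\<close>, so \<open>e\<close> vanishes nowhere on the cycle, which therefore is a
  closed walk in the graphs of all programs with \<open>e\<close> at infinity. On an edge \<open>X, Y\<close>, compare the
  cocircuit \<open>Z\<close> with \<open>Z p = 0\<close> to the cocircuit \<open>Z\<^sub>0\<close> with \<open>Z\<^sub>0 e = 0\<close>: it is infinitesimally close, so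
  \<open>Z f = Z\<^sub>0 f\<close> if \<open>Z\<^sub>0 f \<noteq> 0\<close>, and Euclideanness of \<open>(e, f)\<close> forces \<open>Z\<^sub>0 f = 0\<close> on all edges. Then \<open>f\<close> is
  parallel to \<open>e\<close> on the coline of \<open>X\<close> and \<open>Y\<close>, which gives \<open>Z f = - c * \<sigma> Z\<^sub>0\<close>. Since no \<open>Z f\<close> is
  negative, Euclideanness of \<open>(e, d)\<close> for the list elements \<open>d\<close> after \<open>e\<close>, taken in order, shows
  that they all vanish on every \<open>Z\<^sub>0\<close>; hence \<open>\<sigma> Z\<^sub>0 = 0\<close> and all edges are undirected.\<close>

section \<open>Colines and cocircuit elimination\<close>

lemma cocircuit_elim_commute: "cocircuit_elim L e X Y = cocircuit_elim L e Y X"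
proof -
  have "supp (sv_comp X Y) = supp (sv_comp Y X)" by (auto simp: supp_def sv_comp_def)
  then show ?thesis unfolding cocircuit_elim_def by (metis (no_types, lifting))
qed

text \<open>A rank-free substitute for the statement that the flat \<open>F\<close> has corank at most 2.\<close>

definition coline :: "'a set \<Rightarrow> 'a sign_vec set \<Rightarrow> 'a set \<Rightarrow> bool" where
  "coline E L F \<longleftrightarrow> (\<forall>g\<in>E - F. \<forall>V\<in>L. \<forall>W\<in>L. V \<noteq> (\<lambda>_. 0) \<and> W \<noteq> (\<lambda>_. 0) \<and>
     (\<forall>h\<in>insert g F. V h = 0 \<and> W h = 0) \<longrightarrow> supp V = supp W)"

lemma colineD:
  assumes "coline E L F" "g \<in> E - F" "V \<in> L" "W \<in> L" "V \<noteq> (\<lambda>_. 0)" "W \<noteq> (\<lambda>_. 0)"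
    and "\<And>h. h \<in> insert g F \<Longrightarrow> V h = 0" "\<And>h. h \<in> insert g F \<Longrightarrow> W h = 0"
  shows "supp V = supp W"
  using assms(1) unfolding coline_def using assms(2-) by blast

locale oriented_matroid_covectors =
  fixes E :: "'a set" and L :: "'a sign_vec set"
  assumes om: "oriented_matroid E L"
begin

lemma finite_ground: "finite E"
  and uminus_covector: "X \<in> L \<Longrightarrow> - X \<in> L"
  and comp_covector: "X \<in> L \<Longrightarrow> Y \<in> L \<Longrightarrow> sv_comp X Y \<in> L"
  and covector_sign_vectors: "X \<in> L \<Longrightarrow> X \<in> sign_vectors E"
  using om by (simp_all add: oriented_matroid_def subset_iff)

lemma covector_sign: "X \<in> L \<Longrightarrow> X h = -1 \<or> X h = 0 \<or> X h = 1"
  by (drule covector_sign_vectors) (auto simp: sign_vectors_def)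

lemma covector_outside: "X \<in> L \<Longrightarrow> h \<notin> E \<Longrightarrow> X h = 0"
  by (drule covector_sign_vectors) (simp add: sign_vectors_def)

lemma covector_elimination:
  assumes "X \<in> L" "Y \<in> L" "X e = - Y e" "X e \<noteq> 0"
  obtains Z where "Z \<in> L" "Z e = 0" "\<And>h. h \<notin> sep X Y \<Longrightarrow> Z h = sv_comp X Y h"
proof -
  have "e \<in> sep X Y" using assms by (simp add: sep_def)
  then obtain Z where Z: "Z \<in> L" "Z e = 0" "\<forall>h\<in>E - sep X Y. Z h = sv_comp X Y h"
    using om assms(1,2) by (simp add: oriented_matroid_def) blast
  have "Z h = sv_comp X Y h" if "h \<notin> sep X Y" for h
    using Z that covector_outside[OF assms(1)] covector_outside[OF assms(2)] covector_outside[OF Z(1)]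
    by (cases "h \<in> E") (auto simp: sv_comp_def)
  with Z that show thesis by blast
qed

text \<open>Either \<open>Y\<close> or \<open>- Y\<close> is opposite to \<open>X\<close> at
  \<open>e\<close>, and \<open>s\<close> records which of them is used. This suffices whenever only
  entries matter at which \<open>X\<close> or \<open>Y\<close> vanishes.\<close>

lemma covector_elimination_opposite:
  assumes "X \<in> L" "Y \<in> L" "X e \<noteq> 0" "Y e \<noteq> 0"
  obtains Z s where "Z \<in> L" "Z e = 0" "s = 1 \<or> s = -1"
    "\<And>h. Y h = 0 \<Longrightarrow> Z h = X h" "\<And>h. X h = 0 \<Longrightarrow> Z h = s * Y h"
proof (cases "X e = - Y e")
  case True
  then obtain Z where "Z \<in> L" "Z e = 0" "\<And>h. h \<notin> sep X Y \<Longrightarrow> Z h = sv_comp X Y h"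
    using covector_elimination[OF assms(1,2)] assms by metis
  then show thesis using that[of Z 1] by (auto simp: sep_def sv_comp_def)
next
  case False
  then have eq: "X e = - (- Y) e" using covector_sign assms by (smt (verit) uminus_apply)
  then obtain Z where "Z \<in> L" "Z e = 0" "\<And>h. h \<notin> sep X (- Y) \<Longrightarrow> Z h = sv_comp X (- Y) h"
    using covector_elimination[OF assms(1) uminus_covector[OF assms(2)]] assms by metis
  then show thesis using that[of Z "-1"] by (auto simp: sep_def sv_comp_def)
qed

section \<open>Independence and rank in terms of covectors\<close>

lemma notin_closure_iff:
  assumes "A \<subseteq> E" "e \<in> E"
  shows "e \<notin> mat_closure E L A \<longleftrightarrow> (\<exists>V\<in>L. (\<forall>a\<in>A. V a = 0) \<and> V e \<noteq> 0)"
proof -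
  have "A \<subseteq> zero_set E V \<longleftrightarrow> (\<forall>a\<in>A. V a = 0)" "e \<notin> zero_set E V \<longleftrightarrow> V e \<noteq> 0" for V
    using assms by (auto simp: zero_set_def supp_def)
  then show ?thesis by (simp add: mat_closure_def flats_def)
qed

text \<open>With independence expressed by witnessing covectors, covector elimination takes the
  place of the matroid axioms below.\<close>

lemma indep_iff:
  "mat_indep E L A \<longleftrightarrow> A \<subseteq> E \<and> (\<forall>e\<in>A. \<exists>V\<in>L. (\<forall>a\<in>A - {e}. V a = 0) \<and> V e \<noteq> 0)"
proof -
  have "(e \<notin> mat_closure E L (A - {e})) = (\<exists>V\<in>L. (\<forall>a\<in>A - {e}. V a = 0) \<and> V e \<noteq> 0)"
    if "A \<subseteq> E" "e \<in> A" for e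
    using that by (intro notin_closure_iff) auto
  then show ?thesis unfolding mat_indep_def by (intro conj_cong ball_cong) auto
qed

lemma indep_subset: "mat_indep E L A \<Longrightarrow> B \<subseteq> A \<Longrightarrow> mat_indep E L B"
proof -
  assume A: "mat_indep E L A" and B: "B \<subseteq> A"
  have "\<exists>V\<in>L. (\<forall>a\<in>B - {e}. V a = 0) \<and> V e \<noteq> 0" if e: "e \<in> B" for e
  proof -
    obtain V where "V \<in> L" "\<forall>a\<in>A - {e}. V a = 0" "V e \<noteq> 0"
      using A B e unfolding indep_iff by blast
    then show ?thesis using B by blast
  qed
  then show ?thesis using A B unfolding indep_iff by blast
qed

text \<open>The witness \<open>W\<close> of an old element \<open>b\<close> may be nonzero at
  \<open>e\<close>. Since \<open>V\<close> vanishes on \<open>A\<close>, eliminating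
  \<open>e\<close> between \<open>W\<close> and \<open>V\<close> repairs this without changing
  \<open>W\<close> on \<open>A\<close>.\<close>

lemma indep_insert:
  assumes A: "mat_indep E L A" and V: "V \<in> L" "\<forall>a\<in>A. V a = 0" "V e \<noteq> 0"
  shows "mat_indep E L (insert e A)"
  unfolding indep_iff
proof (intro conjI ballI)
  show "insert e A \<subseteq> E" using A V covector_outside by (auto simp: indep_iff)
  fix b assume b: "b \<in> insert e A"
  show "\<exists>V\<in>L. (\<forall>a\<in>insert e A - {b}. V a = 0) \<and> V b \<noteq> 0"
  proof (cases "b = e")
    case True
    then show ?thesis using V by auto
  next
    case False
    then have "b \<in> A" using b by auto
    then obtain W where W: "W \<in> L" "\<forall>a\<in>A - {b}. W a = 0" "W b \<noteq> 0"
      using A unfolding indep_iff by blast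
    show ?thesis
    proof (cases "W e = 0")
      case True
      then show ?thesis using W by auto
    next
      case neq: False
      obtain Z s where Z: "Z \<in> L" "Z e = 0" "s = 1 \<or> s = -1"
        "\<And>h. V h = 0 \<Longrightarrow> Z h = W h" "\<And>h. W h = 0 \<Longrightarrow> Z h = s * V h"
        using covector_elimination_opposite[OF W(1) V(1) neq V(3)] by blast
      then have "Z b \<noteq> 0" "\<forall>a\<in>insert e A - {b}. Z a = 0"
        using W V \<open>b \<in> A\<close> by auto
      then show ?thesis using Z(1) by blast
    qed
  qed
qed

text \<open>Steinitz exchange. \<open>S\<close> spans in the sense that only the zero covector
  vanishes on it, so the witness for \<open>b\<close> is nonzero at some \<open>s\<close> in
  \<open>S\<close>, and \<open>s\<close> can replace \<open>b\<close>.\<close>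

lemma card_indep_le_card_spanning:
  assumes "mat_indep E L B" "finite S" "\<And>V. V \<in> L \<Longrightarrow> \<forall>a\<in>S. V a = 0 \<Longrightarrow> V = (\<lambda>_. 0)"
  shows "card B \<le> card S"
  using assms(1)
proof (induction "card (B - S)" arbitrary: B rule: less_induct)
  case less
  have finB: "finite B" using less.prems finite_ground by (auto simp: indep_iff intro: finite_subset)
  show ?case
  proof (cases "B \<subseteq> S")
    case True
    then show ?thesis using assms(2) by (rule card_mono[rotated])
  next
    case False
    then obtain b where b: "b \<in> B" "b \<notin> S" by blast
    then obtain V where V: "V \<in> L" "\<forall>a\<in>B - {b}. V a = 0" "V b \<noteq> 0"
      using less.prems unfolding indep_iff by blast
    then obtain s where s: "s \<in> S" "V s \<noteq> 0" using assms(3) by fastforce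
    have "mat_indep E L (insert s (B - {b}))"
      using indep_insert[OF indep_subset[OF less.prems] V(1,2) s(2)] by blast
    moreover have "insert s (B - {b}) - S \<subset> B - S" using s b by auto
    then have "card (insert s (B - {b}) - S) < card (B - S)"
      using finB by (simp add: psubset_card_mono)
    ultimately have "card (insert s (B - {b})) \<le> card S" using less.hyps by blast
    moreover have "s \<notin> B - {b}" using V(2) s(2) by blast
    then have "card (insert s (B - {b})) = card B"
      using finB b(1) by (simp add: card.remove[of B b] del: card_Diff_insert)
    ultimately show ?thesis by simp
  qed
qed

lemma finite_indep_subsets: "finite {B. B \<subseteq> A \<and> mat_indep E L B}"
  using finite_ground by (auto simp: indep_iff intro: finite_subset[of _ "Pow E"])

lemma indep_empty: "mat_indep E L {}"
  by (simp add: indep_iff)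

lemma card_le_rank: "B \<subseteq> A \<Longrightarrow> mat_indep E L B \<Longrightarrow> card B \<le> mat_rank E L A"
  unfolding mat_rank_def using finite_indep_subsets by (intro Max_ge) auto

lemma rank_attained:
  obtains B where "B \<subseteq> A" "mat_indep E L B" "card B = mat_rank E L A"
proof -
  have "mat_rank E L A \<in> card ` {B. B \<subseteq> A \<and> mat_indep E L B}"
    unfolding mat_rank_def using finite_indep_subsets indep_empty
    by (intro Max_in) auto
  then show thesis using that by auto
qed

lemma rank_mono: "A \<subseteq> B \<Longrightarrow> mat_rank E L A \<le> mat_rank E L B"
  by (rule rank_attained[of A]) (metis card_le_rank order_trans)

lemma rank_less:
  assumes "A \<subseteq> B" "e \<in> B" "V \<in> L" "\<forall>a\<in>A. V a = 0" "V e \<noteq> 0"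
  shows "mat_rank E L A < mat_rank E L B"
proof -
  obtain C where C: "C \<subseteq> A" "mat_indep E L C" "card C = mat_rank E L A"
    by (rule rank_attained)
  have "mat_indep E L (insert e C)" using indep_insert[OF C(2) assms(3)] C assms by blast
  then have "card (insert e C) \<le> mat_rank E L B" using C assms by (intro card_le_rank) auto
  moreover have "e \<notin> C" "finite C" using C assms finite_ground
    by (auto simp: indep_iff intro: finite_subset)
  ultimately show ?thesis using C by simp
qed

text \<open>Cocircuits are minimal for the face order; a covector with smaller support can be
  moved towards \<open>X\<close> by elimination until it becomes a face of \<open>X\<close>.\<close>

lemma cocircuit_support_minimal:
  assumes X: "X \<in> cocircuits L" and V: "V \<in> L" "supp V \<subset> supp X"
  shows "V = (\<lambda>_. 0)"
  using V
proof (induction "card (sep X V)" arbitrary: V rule: less_induct)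
  case less
  have XL: "X \<in> L" using X by (simp add: cocircuits_def)
  have fin: "finite (sep X V)"
    using covector_outside[OF XL] by (intro finite_subset[OF _ finite_ground]) (auto simp: sep_def)
  show ?case
  proof (cases "sep X V = {}")
    case True
    have "V h = 0 \<or> V h = X h" for h
    proof -
      have "\<not> (X h = - V h \<and> X h \<noteq> 0)" using True by (auto simp: sep_def)
      moreover have "V h \<noteq> 0 \<Longrightarrow> X h \<noteq> 0" using less.prems by (auto simp: supp_def)
      ultimately show ?thesis
        using covector_sign[OF XL, of h] covector_sign[OF less.prems(1), of h] by auto
    qed
    then have "face_le V X" by (simp add: face_le_def)
    then show ?thesis using X less.prems by (auto simp: cocircuits_def)
  next
    case False
    then obtain h where h: "h \<in> sep X V" by blast
    then obtain Z where Z: "Z \<in> L" "Z h = 0" "\<And>k. k \<notin> sep X V \<Longrightarrow> Z k = sv_comp X V k"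
      using covector_elimination[OF XL less.prems(1), of h] by (auto simp: sep_def)
    obtain k where k: "k \<in> supp X" "k \<notin> supp V" using less.prems by blast
    have Zk: "Z k \<noteq> 0" using Z(3)[of k] k by (auto simp: supp_def sep_def sv_comp_def)
    have "supp Z \<subseteq> supp X"
    proof
      fix a assume "a \<in> supp Z"
      then show "a \<in> supp X"
        using Z(3)[of a] less.prems by (cases "a \<in> sep X V") (auto simp: supp_def sep_def sv_comp_def)
    qed
    moreover have "h \<in> supp X" using h by (auto simp: sep_def supp_def)
    moreover have "h \<notin> supp Z" using Z by (auto simp: supp_def)
    ultimately have "supp Z \<subset> supp X" by blast
    moreover have "sep X Z \<subset> sep X V"
    proof -
      have "a \<in> sep X V" if "a \<in> sep X Z" for a
        using that Z(3)[of a] by (cases "a \<in> sep X V") (auto simp: sep_def sv_comp_def)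
      moreover have "h \<notin> sep X Z" using Z by (auto simp: sep_def)
      ultimately show ?thesis using h by blast
    qed
    then have "card (sep X Z) < card (sep X V)" using fin by (simp add: psubset_card_mono)
    ultimately have "Z = (\<lambda>_. 0)" using less.hyps Z(1) by blast
    then show ?thesis using Zk by simp
  qed
qed

section \<open>Corank of cocircuits, and colines\<close>

lemma cocircuit_rank:
  assumes X: "X \<in> cocircuits L"
  shows "mat_rank E L E \<le> Suc (mat_rank E L (zero_set E X))"
proof -
  have XL: "X \<in> L" and nz: "X \<noteq> (\<lambda>_. 0)" using X by (auto simp: cocircuits_def)
  then obtain e where e: "X e \<noteq> 0" by auto
  obtain A where A: "A \<subseteq> zero_set E X" "mat_indep E L A" "card A = mat_rank E L (zero_set E X)"
    by (rule rank_attained)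
  have finA: "finite A" using A(2) finite_ground by (auto simp: indep_iff intro: finite_subset)
  \<comment> \<open>Maximality of \<open>A\<close>: otherwise \<open>insert h A\<close> would be a
    larger independent subset of the zero set. So whatever vanishes on \<open>A\<close> vanishes on
    the whole zero set, and \<open>insert e A\<close> spans.\<close>
  have van: "V h = 0" if "V \<in> L" "\<forall>a\<in>A. V a = 0" "h \<in> zero_set E X" for V h
  proof (rule ccontr)
    assume "V h \<noteq> 0"
    then have "mat_indep E L (insert h A)" "h \<notin> A" using indep_insert[OF A(2)] that by auto
    then have "card (insert h A) \<le> mat_rank E L (zero_set E X)" using A that
      by (intro card_le_rank) auto
    then show False using A finA \<open>h \<notin> A\<close> by simp
  qed
  have "V = (\<lambda>_. 0)" if "V \<in> L" "\<forall>a\<in>insert e A. V a = 0" for V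
  proof (rule cocircuit_support_minimal[OF X that(1)])
    have "h \<in> supp X" if "h \<in> supp V" for h
      using that van[OF \<open>V \<in> L\<close>, of h] covector_outside[OF \<open>V \<in> L\<close>, of h] \<open>\<forall>a\<in>insert e A. V a = 0\<close>
      by (auto simp: supp_def zero_set_def)
    moreover have "e \<in> supp X" "e \<notin> supp V" using e that by (auto simp: supp_def)
    ultimately show "supp V \<subset> supp X" by blast
  qed
  then have "card B \<le> card (insert e A)" if "mat_indep E L B" for B
    using that finA by (intro card_indep_le_card_spanning) auto
  moreover have "card (insert e A) \<le> Suc (card A)" by (simp add: card_insert_le_m1 finA card_insert_if)
  moreover obtain B where "mat_indep E L B" "card B = mat_rank E L E" by (rule rank_attained)
  ultimately show ?thesis using A(3) by (metis order_trans)
qed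

text \<open>Both zero sets have corank at most 1, so modularity bounds the corank of their
  intersection by 2. Two different supports would give a chain from \<open>?F\<close> through
  \<open>?G\<close> and \<open>zero_set E V\<close> up to \<open>E\<close> with three strict
  increases of rank.\<close>

lemma coline_comodular:
  assumes "comodular E L X Y"
  shows "coline E L (zero_set E X \<inter> zero_set E Y)"
proof -
  let ?F = "zero_set E X \<inter> zero_set E Y"
  let ?r = "mat_rank E L"
  have XY: "X \<in> cocircuits L" "Y \<in> cocircuits L" "X \<in> L" "Y \<in> L"
    and mod: "?r (zero_set E X) + ?r (zero_set E Y) = ?r (zero_set E X \<union> zero_set E Y) + ?r ?F"
    using assms by (auto simp: comodular_def modular_pair_def cocircuits_def)
  have "?r (zero_set E X \<union> zero_set E Y) \<le> ?r E" by (rule rank_mono) (auto simp: zero_set_def)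
  then have rF: "?r E \<le> ?r ?F + 2"
    using cocircuit_rank[OF XY(1)] cocircuit_rank[OF XY(2)] mod by linarith
  have sub: "supp W \<subseteq> supp V"
    if g: "g \<in> E - ?F" and V: "V \<in> L" "W \<in> L" "V \<noteq> (\<lambda>_. 0)"
      and z: "\<forall>h\<in>insert g ?F. V h = 0 \<and> W h = 0" for g V W
  proof (rule ccontr)
    assume "\<not> supp W \<subseteq> supp V"
    then obtain h where h: "V h = 0" "W h \<noteq> 0" by (auto simp: supp_def)
    obtain k where k: "V k \<noteq> 0" using V by auto
    let ?G = "zero_set E V \<inter> zero_set E W"
    have "sv_comp X Y \<in> L" using comp_covector XY by blast
    moreover have "\<forall>a\<in>?F. sv_comp X Y a = 0" "sv_comp X Y g \<noteq> 0"
      using g by (auto simp: zero_set_def supp_def sv_comp_def)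
    moreover have "?F \<subseteq> ?G" "g \<in> ?G" using g z by (auto simp: zero_set_def supp_def)
    ultimately have 1: "?r ?F < ?r ?G" by (intro rank_less[of _ _ g "sv_comp X Y"])
    have 2: "?r ?G < ?r (zero_set E V)"
      using h V covector_outside[OF V(2), of h]
      by (intro rank_less[of _ _ h W]) (auto simp: zero_set_def supp_def)
    have 3: "?r (zero_set E V) < ?r E"
      using k V covector_outside[OF V(1), of k]
      by (intro rank_less[of _ _ k V]) (auto simp: zero_set_def supp_def)
    show False using 1 2 3 rF by linarith
  qed
  show ?thesis unfolding coline_def
  proof (intro ballI impI)
    fix g V W
    assume "g \<in> E - ?F" "V \<in> L" "W \<in> L"
      and "V \<noteq> (\<lambda>_. 0) \<and> W \<noteq> (\<lambda>_. 0) \<and> (\<forall>h\<in>insert g ?F. V h = 0 \<and> W h = 0)"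
    then show "supp V = supp W" using sub[of g V W] sub[of g W V] by blast
  qed
qed

text \<open>Otherwise elimination at \<open>a\<close>, where \<open>V\<close> and \<open>W\<close>
  are opposite, keeps the entry at \<open>b\<close>, where they agree. The result is a nonzero
  covector of the coline with too small a support.\<close>

lemma coline_unique_up_to_sign:
  assumes F: "coline E L F" "g \<in> E - F" and V: "V \<in> L" "V \<noteq> (\<lambda>_. 0)" and W: "W \<in> L" "W \<noteq> (\<lambda>_. 0)"
    and z: "\<And>h. h \<in> insert g F \<Longrightarrow> V h = 0" "\<And>h. h \<in> insert g F \<Longrightarrow> W h = 0"
  shows "V = W \<or> V = - W"
proof (rule ccontr)
  assume neg: "\<not> (V = W \<or> V = - W)"
  have eq: "supp V = supp W" using assms by (intro colineD[OF F]) auto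
  then have s: "V h = 0 \<longleftrightarrow> W h = 0" for h by (auto simp: supp_def)
  obtain a where a: "V a \<noteq> W a" using neg by auto
  obtain b where b: "V b \<noteq> - W b" using neg by fastforce
  have "V a = - W a" "V a \<noteq> 0"
    using a s[of a] covector_sign[OF V(1), of a] covector_sign[OF W(1), of a] by auto
  then obtain Z where Z: "Z \<in> L" "Z a = 0" "\<And>h. h \<notin> sep V W \<Longrightarrow> Z h = sv_comp V W h"
    using covector_elimination[OF V(1) W(1)] by metis
  have "Z b \<noteq> 0" using Z(3)[of b] b s[of b] by (auto simp: sep_def sv_comp_def)
  moreover have "Z h = 0" if "h \<in> insert g F" for h
    using Z(3)[of h] z[OF that] by (auto simp: sep_def sv_comp_def)
  ultimately have "supp Z = supp V" using Z(1) V z by (intro colineD[OF F]) auto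
  then show False using Z(2) \<open>V a \<noteq> 0\<close> by (auto simp: supp_def)
qed

lemma coline_cocircuit:
  assumes F: "coline E L F" "g \<in> E - F" and V: "V \<in> L" "V \<noteq> (\<lambda>_. 0)"
    and z: "\<And>h. h \<in> insert g F \<Longrightarrow> V h = 0"
  shows "V \<in> cocircuits L"
proof -
  have "W = V" if W: "W \<in> L" "W \<noteq> (\<lambda>_. 0)" "face_le W V" for W
  proof -
    have "W h = 0" if "h \<in> insert g F" for h using z[OF that] W by (auto simp: face_le_def)
    then have "supp W = supp V" using W V z by (intro colineD[OF F]) auto
    then show ?thesis using W(3) by (auto simp: face_le_def supp_def fun_eq_iff)
  qed
  then show ?thesis using V by (auto simp: cocircuits_def)
qed

text \<open>\<open>Z\<close> puts \<open>f\<close> into the span of \<open>F\<close> and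
  \<open>g\<close>. A difference at \<open>f\<close> would survive the elimination of
  \<open>g\<close> between \<open>- V\<close> and \<open>W\<close>, and the result could be neither
  \<open>Z\<close> nor \<open>- Z\<close>.\<close>

lemma coline_parallel:
  assumes F: "coline E L F" "g \<in> E - F" and Z: "Z \<in> L" "Z \<noteq> (\<lambda>_. 0)" "Z g = 0" "Z f = 0"
    and V: "V \<in> L" and W: "W \<in> L" and eq: "V g = W g" "V g \<noteq> 0"
    and z: "\<And>h. h \<in> F \<Longrightarrow> V h = 0" "\<And>h. h \<in> F \<Longrightarrow> W h = 0" "\<And>h. h \<in> F \<Longrightarrow> Z h = 0"
  shows "V f = W f"
proof (rule ccontr)
  assume ne: "V f \<noteq> W f"
  obtain U where U: "U \<in> L" "U g = 0" "\<And>h. h \<notin> sep (- V) W \<Longrightarrow> U h = sv_comp (- V) W h"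
    using covector_elimination[OF uminus_covector[OF V] W, of g] eq by (metis neg_equal_0_iff_equal uminus_apply)
  have Uf: "U f \<noteq> 0" using U(3)[of f] ne by (auto simp: sep_def sv_comp_def)
  have "U h = 0" if "h \<in> F" for h using U(3)[of h] z that by (auto simp: sep_def sv_comp_def)
  then have "U = Z \<or> U = - Z" using Z U Uf z by (intro coline_unique_up_to_sign[OF F]) auto
  then show False using Uf Z by auto
qed

section \<open>Elimination between comodular cocircuits\<close>

lemma cocircuit_elim_unique:
  assumes F: "coline E L (zero_set E X \<inter> zero_set E Y)"
    and X: "X \<in> L" and Y: "Y \<in> L" and e: "e \<in> sep X Y" and ne: "X \<noteq> - Y"
    and Z: "Z \<in> L" "Z e = 0" "\<And>h. h \<notin> sep X Y \<Longrightarrow> Z h = sv_comp X Y h"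
  shows "cocircuit_elim L e X Y = Z"
  unfolding cocircuit_elim_def
proof (rule the_equality)
  let ?F = "zero_set E X \<inter> zero_set E Y"
  have eE: "e \<in> E - ?F" using e covector_outside[OF X, of e] by (auto simp: sep_def zero_set_def supp_def)
  \<comment> \<open>The entries at \<open>k\<close> are not opposite, so elimination leaves a
    nonzero entry there. It shows that \<open>Z\<close> is nonzero and later rules out the candidate
    \<open>- Z\<close>.\<close>
  obtain k where k: "X k \<noteq> - Y k" using ne by (auto simp: fun_eq_iff)
  have kns: "k \<notin> sep X Y" using k by (simp add: sep_def)
  have Zk: "Z k \<noteq> 0" using Z(3)[OF kns] k by (auto simp: sv_comp_def split: if_splits)
  then have Znz: "Z \<noteq> (\<lambda>_. 0)" by auto
  have z: "Z h = 0" if "h \<in> insert e ?F" for h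
    using that Z(2) Z(3)[of h] by (auto simp: zero_set_def supp_def sep_def sv_comp_def)
  have ZE: "supp Z \<subseteq> supp (sv_comp X Y)"
  proof
    fix h assume "h \<in> supp Z"
    then show "h \<in> supp (sv_comp X Y)"
      using Z(3)[of h] by (cases "h \<in> sep X Y") (auto simp: supp_def sep_def sv_comp_def)
  qed
  have "Z h = X h \<or> Z h = Y h" if "h \<in> supp Z" for h
    using that Z(3)[of h] covector_sign[OF Z(1), of h] covector_sign[OF X, of h]
    by (cases "h \<in> sep X Y") (auto simp: supp_def sep_def sv_comp_def split: if_splits)
  then show "Z \<in> cocircuits L \<and> Z e = 0 \<and> supp Z \<subseteq> supp (sv_comp X Y) - {e} \<and>
     (\<forall>h\<in>supp Z. Z h = X h \<or> Z h = Y h)"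
    using coline_cocircuit[OF F eE Z(1) Znz z] Z(2) ZE by (auto simp: supp_def)
  fix V assume V: "V \<in> cocircuits L \<and> V e = 0 \<and> supp V \<subseteq> supp (sv_comp X Y) - {e} \<and>
     (\<forall>h\<in>supp V. V h = X h \<or> V h = Y h)"
  have "V h = 0" if "h \<in> insert e ?F" for h
    using that V by (auto simp: zero_set_def supp_def sv_comp_def split: if_splits)
  then have "V = Z \<or> V = - Z" using V Z(1) Znz z
    by (intro coline_unique_up_to_sign[OF F eE]) (auto simp: cocircuits_def)
  moreover have "V \<noteq> - Z"
  proof
    assume "V = - Z"
    then have "V k = - Z k" "V k \<noteq> 0" using Zk by auto
    moreover from this have "k \<in> supp V" by (simp add: supp_def)
    then have "V k = X k \<or> V k = Y k" using V by blast
    ultimately show False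
      using Z(3)[OF kns] k Zk covector_sign[OF X, of k] covector_sign[OF Y, of k]
      by (auto simp: sv_comp_def split: if_splits)
  qed
  ultimately show "V = Z" by blast
qed

lemma cocircuit_elim_covector:
  assumes "coline E L (zero_set E X \<inter> zero_set E Y)" "X \<in> L" "Y \<in> L" "e \<in> sep X Y" "X \<noteq> - Y"
  shows "cocircuit_elim L e X Y \<in> L" "cocircuit_elim L e X Y e = 0"
    "\<And>h. h \<notin> sep X Y \<Longrightarrow> cocircuit_elim L e X Y h = sv_comp X Y h"
proof -
  obtain Z where Z: "Z \<in> L" "Z e = 0" "\<And>h. h \<notin> sep X Y \<Longrightarrow> Z h = sv_comp X Y h"
    using covector_elimination[OF assms(2,3), of e] assms(4) by (auto simp: sep_def)
  then have "cocircuit_elim L e X Y = Z" using assms by (intro cocircuit_elim_unique) auto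
  then show "cocircuit_elim L e X Y \<in> L" "cocircuit_elim L e X Y e = 0"
    "\<And>h. h \<notin> sep X Y \<Longrightarrow> cocircuit_elim L e X Y h = sv_comp X Y h" using Z by auto
qed

lemma cocircuit_elim_uminus:
  assumes "coline E L (zero_set E X \<inter> zero_set E Y)" "X \<in> L" "Y \<in> L" "e \<in> sep X Y" "X \<noteq> - Y"
  shows "cocircuit_elim L e (- X) (- Y) = - cocircuit_elim L e X Y"
proof (rule cocircuit_elim_unique)
  have [simp]: "sep (- X) (- Y) = sep X Y" "zero_set E (- X) = zero_set E X"
    "zero_set E (- Y) = zero_set E Y"
    by (auto simp: sep_def zero_set_def supp_def)
  note * = cocircuit_elim_covector[OF assms]
  show "coline E L (zero_set E (- X) \<inter> zero_set E (- Y))" "e \<in> sep (- X) (- Y)" using assms by auto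
  show "- X \<in> L" "- Y \<in> L" "- cocircuit_elim L e X Y \<in> L" using uminus_covector assms * by auto
  show "- X \<noteq> - (- Y)" using assms(5) by (auto simp: fun_eq_iff) (metis minus_minus)
  show "(- cocircuit_elim L e X Y) e = 0" using * by simp
  show "(- cocircuit_elim L e X Y) h = sv_comp (- X) (- Y) h" if "h \<notin> sep (- X) (- Y)" for h
    using *(3)[of h] that by (simp add: sv_comp_def)
qed

lemma comodular_covectors: "comodular E L X Y \<Longrightarrow> X \<in> L" "comodular E L X Y \<Longrightarrow> Y \<in> L"
  by (auto simp: comodular_def cocircuits_def)

lemma comodular_elim_aux:
  assumes "comodular E L X Y" "X g = Y g" "X g \<noteq> 0"
  shows "coline E L (zero_set E (- X) \<inter> zero_set E Y)" "- X \<in> L" "Y \<in> L" "g \<in> sep (- X) Y" "- X \<noteq> - Y"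
proof -
  have "zero_set E (- X) = zero_set E X" by (auto simp: zero_set_def supp_def)
  then show "coline E L (zero_set E (- X) \<inter> zero_set E Y)" using coline_comodular[OF assms(1)] by simp
  show "- X \<in> L" "Y \<in> L" using comodular_covectors[OF assms(1)] uminus_covector by auto
  show "g \<in> sep (- X) Y" using assms by (simp add: sep_def)
  show "- X \<noteq> - Y" using assms(1) by (auto simp: comodular_def fun_eq_iff)
qed

lemma comodular_elim:
  assumes "comodular E L X Y" "X g = Y g" "X g \<noteq> 0"
  shows "cocircuit_elim L g (- X) Y \<in> L" "cocircuit_elim L g (- X) Y g = 0"
    "\<And>h. h \<notin> sep (- X) Y \<Longrightarrow> cocircuit_elim L g (- X) Y h = sv_comp (- X) Y h"
  using cocircuit_elim_covector[OF comodular_elim_aux[OF assms]] by auto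

text \<open>The term \<open>- (- X)\<close> has the shape that arises when every vertex of a walk is
  negated.\<close>

lemma comodular_elim_uminus:
  assumes "comodular E L X Y" "X g = Y g" "X g \<noteq> 0"
  shows "cocircuit_elim L g (- (- X)) (- Y) = - cocircuit_elim L g (- X) Y"
  using cocircuit_elim_uminus[OF comodular_elim_aux[OF assms]] .

text \<open>Elimination is symmetric in its two arguments, so swapping the ends of an edge amounts
  to negating both arguments. This is what reverses walks.\<close>

lemma comodular_elim_reverse:
  assumes "comodular E L X Y" "X g = Y g" "X g \<noteq> 0"
  shows "cocircuit_elim L g (- Y) X = - cocircuit_elim L g (- X) Y"
proof -
  have "- (- X) = X" by (simp add: fun_eq_iff)
  then show ?thesis using comodular_elim_uminus[OF assms] by (metis cocircuit_elim_commute)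
qed

text \<open>If the eliminated cocircuit vanishes at \<open>f\<close>, then \<open>f\<close> is in
  the span of the coline and \<open>g\<close>, and ends that agree at \<open>g\<close> agree at
  \<open>f\<close>. If its entry is 1 and the ends differ at \<open>f\<close>, this entry is
  inherited from \<open>- X\<close> or from \<open>Y\<close>.\<close>

lemma edge_objective_mono:
  assumes adj: "comodular E L X Y" "X g = Y g" "X g \<noteq> 0" and fwd: "0 \<le> cocircuit_elim L g (- X) Y f"
  shows "X f \<le> Y f"
proof -
  let ?Z = "cocircuit_elim L g (- X) Y"
  let ?F = "zero_set E X \<inter> zero_set E Y"
  note Z = comodular_elim[OF adj]
  note XY = comodular_covectors[OF adj(1)]
  have z: "X h = 0" "Y h = 0" if "h \<in> ?F" for h using that by (auto simp: zero_set_def supp_def)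
  have "X f = Y f" if Zf: "?Z f = 0"
  proof (rule coline_parallel[OF coline_comodular[OF adj(1)] _ Z(1) _ Z(2) Zf XY adj(2,3) z])
    show "g \<in> E - ?F" using adj covector_outside[OF XY(1), of g] by (auto simp: zero_set_def supp_def)
    obtain k where "X k \<noteq> Y k" using adj(1) by (auto simp: comodular_def fun_eq_iff)
    then have "?Z k \<noteq> 0" using Z(3)[of k] by (auto simp: sep_def sv_comp_def)
    then show "?Z \<noteq> (\<lambda>_. 0)" by auto
    show "?Z h = 0" if "h \<in> ?F" for h using Z(3)[of h] z[OF that] by (auto simp: sep_def sv_comp_def)
  qed
  moreover have "X f \<le> Y f" if "?Z f = 1" "X f \<noteq> Y f"
    using Z(3)[of f] that covector_sign[OF XY(1), of f] covector_sign[OF XY(2), of f]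
    by (auto simp: sep_def sv_comp_def split: if_splits)
  ultimately show ?thesis using fwd covector_sign[OF Z(1), of f]
    by (cases "X f = Y f") auto
qed

text \<open>If \<open>V f\<close> were nonzero, a basis of the zero set of \<open>V\<close> together
  with \<open>e\<close> would be a basis of \<open>E\<close> that avoids \<open>f\<close>. This
  covers the objectives \<open>f\<close> for which \<open>(e, f)\<close> is not a program because
  \<open>f\<close> is a coloop.\<close>

lemma coloop_vanishes:
  assumes f: "mat_coloop E L f" and V: "V \<in> cocircuits L" and e: "V e \<noteq> 0" "f \<noteq> e"
  shows "V f = 0"
proof (rule ccontr)
  assume nz: "V f \<noteq> 0"
  have VL: "V \<in> L" using V by (simp add: cocircuits_def)
  obtain A where A: "A \<subseteq> zero_set E V" "mat_indep E L A" "card A = mat_rank E L (zero_set E V)"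
    by (rule rank_attained)
  have VA: "\<forall>a\<in>A. V a = 0" using A(1) by (auto simp: zero_set_def supp_def)
  have ind: "mat_indep E L (insert e A)" using indep_insert[OF A(2) VL VA e(1)] .
  have eA: "e \<notin> A" using VA e by auto
  have fin: "finite C" if "mat_indep E L C" for C
    using that finite_ground by (auto simp: mat_indep_def intro: finite_subset)
  have "C = insert e A" if C: "mat_indep E L C" "insert e A \<subseteq> C" for C
  proof -
    have "card C \<le> mat_rank E L E" using C by (intro card_le_rank) (auto simp: mat_indep_def)
    also have "\<dots> \<le> card (insert e A)" using cocircuit_rank[OF V] A(3) fin[OF A(2)] eA by simp
    finally show ?thesis using C fin[OF C(1)] by (metis card_seteq)
  qed
  then have "mat_basis E L (insert e A)" unfolding mat_basis_def using ind by blast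
  then have "f \<in> insert e A" using f unfolding mat_coloop_def by blast
  then show False using e nz VA by auto
qed

end

section \<open>Edges of the extended program\<close>

lemma lex_localization_eq_zero: "(\<And>e. e \<in> fst ` set I \<Longrightarrow> Y e = 0) \<Longrightarrow> lex_localization I Y = 0"
  by (induction I) auto

lemma lex_localization_first_nonzero:
  "(\<And>d. d \<in> fst ` set I \<Longrightarrow> Y d = 0) \<Longrightarrow> Y e \<noteq> 0 \<Longrightarrow> lex_localization (I @ (e, \<alpha>) # J) Y = \<alpha> * Y e"
  by (induction I) auto

text \<open>The common nonzero sign at \<open>f\<close>, available at every edge of a directed
  cycle, keeps the ends from becoming zero or opposite when \<open>p\<close> is deleted.\<close>

locale extension_edge = ext: oriented_matroid_covectors "insert p E" L'
  for E :: "'a set" and L' :: "'a sign_vec set" and p :: 'a +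
  fixes L :: "'a sign_vec set" and \<sigma> :: "'a sign_vec \<Rightarrow> int" and X Y :: "'a sign_vec" and f :: 'a
  assumes base: "oriented_matroid E L"
    and p_new: "p \<notin> E"
    and deletion: "(\<lambda>X. X(p := 0)) ` L' = L"
    and localization: "\<And>V. V \<in> cocircuits L \<Longrightarrow> V(p := \<sigma> V) \<in> cocircuits L'"
    and edge: "graph_adj (insert p E) L' p X Y"
    and f: "f \<in> E" "X f = Y f" "X f \<noteq> 0"
begin

sublocale base: oriented_matroid_covectors E L
  by unfold_locales (rule base)

section \<open>The coline of an edge before and after deleting \<open>p\<close>\<close>

definition "F = zero_set E X \<inter> zero_set E Y"

lemma ends: "X \<in> cocircuits L'" "Y \<in> cocircuits L'" "X \<in> L'" "Y \<in> L'" "X p = 1" "Y p = 1"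
    "X \<noteq> Y" "X \<noteq> - Y" "conformal X Y" "comodular (insert p E) L' X Y"
  using edge by (auto simp: graph_adj_def graph_verts_def comodular_def cocircuits_def)

lemma F_eq: "zero_set (insert p E) X \<inter> zero_set (insert p E) Y = F"
  using ends by (auto simp: F_def zero_set_def supp_def)

lemma coline_ext: "coline (insert p E) L' F"
  using ext.coline_comodular[OF ends(10)] by (simp add: F_eq)

lemma restrict_covector: "V \<in> L' \<Longrightarrow> V(p := 0) \<in> L"
  using deletion by blast

lemma lift_covector:
  assumes "V \<in> L"
  obtains V' where "V' \<in> L'" "V = V'(p := 0)"
  using assms deletion by blast

lemma coline_base: "coline E L F"
  unfolding coline_def
proof (intro ballI impI)
  fix g V W
  assume g: "g \<in> E - F" and V: "V \<in> L" and W: "W \<in> L"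
    and z: "V \<noteq> (\<lambda>_. 0) \<and> W \<noteq> (\<lambda>_. 0) \<and> (\<forall>h\<in>insert g F. V h = 0 \<and> W h = 0)"
  obtain V' where V': "V' \<in> L'" "V = V'(p := 0)" using V by (rule lift_covector)
  obtain W' where W': "W' \<in> L'" "W = W'(p := 0)" using W by (rule lift_covector)
  have pF: "p \<notin> insert g F" using p_new g by (auto simp: F_def zero_set_def)
  have eq: "V' h = V h" "W' h = W h" if "h \<noteq> p" for h using that V' W' by auto
  have "supp V' = supp W'"
  proof (rule colineD[OF coline_ext])
    show "g \<in> insert p E - F" using g by auto
    show "V' \<noteq> (\<lambda>_. 0)" "W' \<noteq> (\<lambda>_. 0)" using z V' W' by auto
    show "V' h = 0" "W' h = 0" if "h \<in> insert g F" for h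
      using eq[of h] that pF z by metis+
  qed (use V' W' in auto)
  then show "supp V = supp W" unfolding V'(2) W'(2) by (auto simp: supp_def set_eq_iff)
qed

lemma zero_on_F: "h \<in> F \<Longrightarrow> X h = 0" "h \<in> F \<Longrightarrow> Y h = 0"
  by (auto simp: F_def zero_set_def supp_def)

lemma notin_F: "X h \<noteq> 0 \<or> Y h \<noteq> 0 \<Longrightarrow> h \<notin> F"
  using zero_on_F by auto

text \<open>A nonzero covector supported on \<open>p\<close> alone would lie properly inside the
  support of the cocircuit \<open>X\<close>, which contains both \<open>p\<close> and
  \<open>f\<close>.\<close>

lemma no_covector_on_p:
  assumes "V \<in> L'" "V(p := 0) = (\<lambda>_. 0)"
  shows "V = (\<lambda>_. 0)"
proof (rule ccontr)
  assume nz: "V \<noteq> (\<lambda>_. 0)"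
  have "V h = 0" if "h \<noteq> p" for h using fun_cong[OF assms(2), of h] that by simp
  then have "supp V \<subseteq> {p}" by (auto simp: supp_def)
  moreover have "p \<in> supp X" "f \<in> supp X" "f \<noteq> p" using ends f p_new by (auto simp: supp_def)
  ultimately have "supp V \<subset> supp X" by blast
  then show False using ext.cocircuit_support_minimal[OF ends(1) assms(1)] nz by blast
qed

text \<open>The localization provides some covector above \<open>V(p := 0)\<close>. On the coline it
  is unique up to sign, and a nonzero entry \<open>k\<close> other than \<open>p\<close> fixes the
  sign.\<close>

lemma covector_value_at_p:
  assumes V: "V \<in> L'" "V \<noteq> (\<lambda>_. 0)" and zF: "\<And>h. h \<in> F \<Longrightarrow> V h = 0"
    and g: "g \<in> E" "g \<notin> F" "V g = 0"
  shows "V(p := 0) \<in> cocircuits L" "V p = \<sigma> (V(p := 0))"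
proof -
  let ?V = "V(p := 0)"
  have nz: "?V \<noteq> (\<lambda>_. 0)" using no_covector_on_p V by blast
  show cc: "?V \<in> cocircuits L"
    using g zF by (intro base.coline_cocircuit[OF coline_base _ restrict_covector[OF V(1)] nz, of g]) auto
  then have W: "?V(p := \<sigma> ?V) \<in> L'" using localization[OF cc] by (simp add: cocircuits_def)
  obtain k where k: "?V k \<noteq> 0" using nz unfolding fun_eq_iff by blast
  then have kp: "k \<noteq> p" by auto
  have "V = ?V(p := \<sigma> ?V) \<or> V = - (?V(p := \<sigma> ?V))"
  proof (rule ext.coline_unique_up_to_sign[OF coline_ext _ V W])
    show "g \<in> insert p E - F" using g by auto
    show "?V(p := \<sigma> ?V) \<noteq> (\<lambda>_. 0)" using k kp by (auto simp: fun_eq_iff)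
    show "V h = 0" if "h \<in> insert g F" for h using that zF g by auto
    show "(?V(p := \<sigma> ?V)) h = 0" if "h \<in> insert g F" for h
      using that zF g p_new by (auto simp: F_def zero_set_def)
  qed
  moreover have "V k \<noteq> (- (?V(p := \<sigma> ?V))) k" using k kp by auto
  ultimately have "V = ?V(p := \<sigma> ?V)" by metis
  then show "V p = \<sigma> ?V" by (metis fun_upd_same)
qed

text \<open>A face of the restriction lifts to a covector whose support lies in that of
  \<open>V\<close>, because \<open>V p\<close> is nonzero. Minimality of the support of
  \<open>V\<close> then gives equality.\<close>

lemma end_restrict:
  assumes V: "V \<in> cocircuits L'" "V p = 1" and nz: "V f \<noteq> 0"
  shows "V(p := 0) \<in> cocircuits L"
  unfolding cocircuits_def
proof (intro CollectI conjI ballI impI)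
  have VL: "V \<in> L'" using V by (simp add: cocircuits_def)
  have fp: "f \<noteq> p" using f p_new by auto
  show "V(p := 0) \<in> L" using VL by (rule restrict_covector)
  show "V(p := 0) \<noteq> (\<lambda>_. 0)" using nz fp by (auto simp: fun_eq_iff)
  fix W assume W: "W \<in> L" and "W \<noteq> (\<lambda>_. 0) \<and> face_le W (V(p := 0))"
  then have Wnz: "W \<noteq> (\<lambda>_. 0)" and le: "face_le W (V(p := 0))" by auto
  obtain W' where W': "W' \<in> L'" "W = W'(p := 0)" using W by (rule lift_covector)
  have "h \<in> supp V" if "h \<in> supp W'" for h
  proof (cases "h = p")
    case False
    have "W h = 0 \<or> W h = (V(p := 0)) h" using le unfolding face_le_def by blast
    then show ?thesis using False that by (simp add: W'(2) supp_def)
  qed (use V(2) in \<open>simp add: supp_def\<close>)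
  then have "supp W' \<subseteq> supp V" by blast
  moreover have "W' \<noteq> (\<lambda>_. 0)" using Wnz W' by auto
  ultimately have "supp W' = supp V" using ext.cocircuit_support_minimal[OF V(1) W'(1)] by blast
  then have s: "W' h = 0 \<longleftrightarrow> V h = 0" for h by (auto simp: supp_def set_eq_iff)
  show "W = V(p := 0)"
  proof
    fix h show "W h = (V(p := 0)) h"
      using le s[of h] W'(2) by (auto simp: face_le_def split: if_splits)
  qed
qed

text \<open>The value 0 would put \<open>V(p := 0)\<close> into \<open>L'\<close>, and the value -1
  would do so after eliminating \<open>p\<close> against \<open>V\<close>. Both contradict the
  minimality of the support of \<open>V\<close>.\<close>

lemma sigma_end:
  assumes "V \<in> cocircuits L'" "V p = 1" "V f \<noteq> 0"
  shows "\<sigma> (V(p := 0)) = 1"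
proof -
  let ?V = "V(p := 0)"
  have VL: "V \<in> L'" using assms by (simp add: cocircuits_def)
  have W: "?V(p := \<sigma> ?V) \<in> L'"
    using localization[OF end_restrict[OF assms]] by (simp add: cocircuits_def)
  have fp: "f \<noteq> p" using f p_new by auto
  have no: "?V \<notin> L'"
  proof
    assume "?V \<in> L'"
    moreover have "supp ?V \<subset> supp V" using assms(2) by (auto simp: supp_def psubset_eq set_eq_iff)
    ultimately have "?V = (\<lambda>_. 0)" using ext.cocircuit_support_minimal[OF assms(1)] by blast
    then have "?V f = 0" by simp
    then show False using assms(3) fp by simp
  qed
  have "\<sigma> ?V \<noteq> 0" using W no by (auto simp: fun_upd_idem)
  moreover have "\<sigma> ?V \<noteq> -1"
  proof
    assume m: "\<sigma> ?V = -1"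
    obtain Z where Z: "Z \<in> L'" "Z p = 0"
      "\<And>h. h \<notin> sep V (?V(p := \<sigma> ?V)) \<Longrightarrow> Z h = sv_comp V (?V(p := \<sigma> ?V)) h"
      using ext.covector_elimination[OF VL W, of p] m assms(2) by auto
    have "Z h = ?V h" for h
      using Z(2) Z(3)[of h] by (cases "h = p") (auto simp: sep_def sv_comp_def)
    then have "Z = ?V" by blast
    then show False using Z(1) no by simp
  qed
  ultimately show ?thesis using ext.covector_sign[OF W, of p] by auto
qed

text \<open>Subsets of \<open>E\<close> have the same rank in both matroids, and \<open>p\<close>
  lies in neither zero set, so the modularity equation carries over. The common sign at
  \<open>f\<close> keeps the restrictions from being opposite.\<close>

lemma comodular_base: "comodular E L (X(p := 0)) (Y(p := 0))"
proof -
  have flats: "A \<subseteq> E \<Longrightarrow> mat_indep (insert p E) L' A \<longleftrightarrow> mat_indep E L A" for A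
    unfolding ext.indep_iff base.indep_iff
  proof (intro conj_cong ball_cong refl)
    fix b assume A: "A \<subseteq> E" and b: "b \<in> A"
    have eq: "((V(p := 0)) h = 0) = (V h = 0)" if "h \<in> A" for V :: "'a sign_vec" and h
      using that A p_new by auto
    show "(\<exists>V\<in>L'. (\<forall>a\<in>A - {b}. V a = 0) \<and> V b \<noteq> 0) = (\<exists>V\<in>L. (\<forall>a\<in>A - {b}. V a = 0) \<and> V b \<noteq> 0)"
      unfolding deletion[symmetric] using eq b by simp
  qed auto
  then have rank: "mat_rank (insert p E) L' A = mat_rank E L A" if "A \<subseteq> E" for A
    unfolding mat_rank_def using that by (metis (no_types, lifting) order_trans)
  have z: "zero_set (insert p E) X = zero_set E (X(p := 0))" "zero_set (insert p E) Y = zero_set E (Y(p := 0))"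
    using ends p_new by (auto simp: zero_set_def supp_def)
  have sub: "zero_set E V \<subseteq> E" for V :: "'a sign_vec" by (auto simp: zero_set_def)
  have "modular_pair E L (zero_set E (X(p := 0))) (zero_set E (Y(p := 0)))"
    using ends(10) sub unfolding comodular_def modular_pair_def z
    by (metis (no_types, lifting) rank sub Un_least le_infI1)
  moreover have "X(p := 0) \<noteq> Y(p := 0)"
    using ends by (metis fun_upd_triv fun_upd_upd)
  moreover have "X(p := 0) \<noteq> - (Y(p := 0))"
  proof
    assume "X(p := 0) = - (Y(p := 0))"
    then have "(X(p := 0)) f = (- (Y(p := 0))) f" by simp
    then show False using f p_new by (auto split: if_splits)
  qed
  ultimately show ?thesis using end_restrict ends f unfolding comodular_def by metis
qed

lemma conformal_base: "conformal (X(p := 0)) (Y(p := 0))"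
  using ends(9) by (auto simp: conformal_def sep_def split: if_splits)

definition "Z = cocircuit_elim L' p (- X) Y"

lemma Z: "Z \<in> L'" "Z p = 0" "\<And>h. h \<notin> sep (- X) Y \<Longrightarrow> Z h = sv_comp (- X) Y h"
  using ext.comodular_elim[OF ends(10), of p] ends unfolding Z_def by auto

text \<open>Elimination at \<open>p\<close> and elimination at \<open>e\<close> leave the same
  nonzero sign wherever the ends differ. Such an entry orients the two results consistently.\<close>

lemma nonseparating_element:
  obtains k where "k \<in> E" "X k \<noteq> Y k" "Z k = sv_comp (- X) Y k" "Z k \<noteq> 0"
proof -
  obtain k where k: "X k \<noteq> Y k" using ends(7) by (auto simp: fun_eq_iff)
  then have "k \<noteq> p" using ends by auto
  then have "k \<in> E" using ext.covector_outside[OF ends(3), of k] ext.covector_outside[OF ends(4), of k] k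
    by (cases "k \<in> E") auto
  moreover have "Z k = sv_comp (- X) Y k" using Z(3)[of k] k by (auto simp: sep_def)
  moreover have "sv_comp (- X) Y k \<noteq> 0" using k by (auto simp: sv_comp_def)
  ultimately show thesis using that k by simp
qed

lemma Z_nonzero: "Z \<noteq> (\<lambda>_. 0)"
  using nonseparating_element by (metis (full_types))

lemma Z_zero_on_F: "h \<in> F \<Longrightarrow> Z h = 0"
  using Z(3)[of h] zero_on_F[of h] by (auto simp: sep_def sv_comp_def)

end

text \<open>Since the list elements before \<open>e\<close> vanish on the edge, \<open>e\<close> decides the localization on the
  coline of \<open>X\<close> and \<open>Y\<close> wherever it does not vanish.\<close>

locale lexicographic_edge = extension_edge E L' p L "lex_localization (I @ (e, \<alpha>) # J)" X Y f
  for E :: "'a set" and L' :: "'a sign_vec set" and p :: 'a and L :: "'a sign_vec set"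
    and I J :: "('a \<times> int) list" and e :: 'a and \<alpha> :: int and X Y :: "'a sign_vec" and f :: 'a +
  assumes list_subset: "fst ` set I \<subseteq> E" "e \<in> E"
    and sign: "\<alpha> = 1 \<or> \<alpha> = -1"
    and initial_zero: "\<And>d. d \<in> fst ` set I \<Longrightarrow> X d = 0" "\<And>d. d \<in> fst ` set I \<Longrightarrow> Y d = 0"
begin

abbreviation "\<sigma> \<equiv> lex_localization (I @ (e, \<alpha>) # J)"

lemma initial_in_F: "d \<in> fst ` set I \<Longrightarrow> d \<in> F"
  using initial_zero list_subset by (auto simp: F_def zero_set_def supp_def)

lemma sigma_eq:
  assumes "\<And>h. h \<in> F \<Longrightarrow> V h = 0" "V e \<noteq> 0"
  shows "\<sigma> V = \<alpha> * V e"
  using assms initial_in_F by (intro lex_localization_first_nonzero) auto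

lemma covector_value_at_p_via_e:
  assumes V: "V \<in> L'" and zF: "\<And>h. h \<in> F \<Longrightarrow> V h = 0" and g: "g \<in> E" "g \<notin> F" "V g = 0"
    and e: "V e \<noteq> 0"
  shows "V p = \<alpha> * V e"
proof -
  have "V p = \<sigma> (V(p := 0))" using covector_value_at_p[OF V _ zF g] e by auto
  also have "\<dots> = \<alpha> * (V(p := 0)) e"
    using zF e list_subset p_new by (intro sigma_eq) (auto simp: fun_upd_def)
  finally show ?thesis using list_subset p_new by auto
qed

text \<open>Where \<open>X\<close> vanishes at \<open>e\<close>, the hyperplane \<open>p\<close> meets the coline infinitesimally close to
  \<open>- X\<close>, so \<open>Z\<close> inherits the sign of \<open>- X\<close> at \<open>f\<close>.\<close>

lemma leaving_hyperplane_aux: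
  assumes W: "W \<in> L'" "W \<noteq> (\<lambda>_. 0)" "W p = 0" "\<And>h. h \<in> F \<Longrightarrow> W h = 0" "W e = \<alpha>"
    and V: "V \<in> L'" "V p = -1" "\<And>h. h \<in> F \<Longrightarrow> V h = 0" "V e = 0" "V f \<noteq> 0"
  shows "W f = V f"
proof (rule ccontr)
  assume ne: "W f \<noteq> V f"
  have fF: "f \<notin> F" using f notin_F by auto
  have a: "\<alpha> * \<alpha> = 1" "\<alpha> \<noteq> 0" using sign by auto
  show False
  proof (cases "W f = 0")
    case True
    then show ?thesis using covector_value_at_p_via_e[OF W(1,4) f(1) fF] W a by auto
  next
    case False
    then have "V f = - W f" using ne V ext.covector_sign[OF W(1), of f] ext.covector_sign[OF V(1), of f] by auto
    \<comment> \<open>On the coline a zero at \<open>f\<close> forces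
      \<open>U p = \<alpha> * U e\<close>, but this \<open>U\<close> has entries -1 at
      \<open>p\<close> and \<alpha> at \<open>e\<close>.\<close>
    then obtain U where U: "U \<in> L'" "U f = 0" "\<And>h. h \<notin> sep V W \<Longrightarrow> U h = sv_comp V W h"
      using ext.covector_elimination[OF V(1) W(1)] V by metis
    have "U p = -1" "U e = \<alpha>" using U(3)[of p] U(3)[of e] V W by (auto simp: sep_def sv_comp_def)
    moreover have "U h = 0" if "h \<in> F" for h using U(3)[of h] V(3) W(4) that by (auto simp: sep_def sv_comp_def)
    ultimately show False using covector_value_at_p_via_e[OF U(1) _ f(1) fF U(2)] a by auto
  qed
qed

lemma end_value_at_e:
  assumes "V = X \<or> V = Y" "V e \<noteq> 0"
  shows "V e = \<alpha>"
proof -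
  have ep: "e \<noteq> p" using list_subset p_new by auto
  have "\<sigma> (V(p := 0)) = 1" using assms(1) sigma_end[of V] ends f by auto
  moreover have "\<sigma> (V(p := 0)) = \<alpha> * V e"
    using sigma_eq[of "V(p := 0)"] assms zero_on_F ep by auto
  ultimately show ?thesis using sign by auto
qed

lemma leaving_hyperplane:
  assumes "X e = 0" "Y e \<noteq> 0"
  shows "Z f = - X f"
proof -
  have "Z e = \<alpha>" using Z(3)[of e] assms end_value_at_e[of Y] by (auto simp: sep_def sv_comp_def)
  then have "Z f = (- X) f"
    using assms ends f zero_on_F
    by (intro leaving_hyperplane_aux[OF Z(1) Z_nonzero Z(2) Z_zero_on_F _ ext.uminus_covector[OF ends(3)]])
      simp_all
  then show ?thesis by simp
qed

text \<open>The same argument seen from the other end: \<open>- Z\<close> and \<open>- Y\<close>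
  take the places of \<open>Z\<close> and \<open>- X\<close>.\<close>

lemma entering_hyperplane:
  assumes "X e \<noteq> 0" "Y e = 0"
  shows "Z f = Y f"
proof -
  have "Z e = - \<alpha>" using Z(3)[of e] assms end_value_at_e[of X] by (auto simp: sep_def sv_comp_def)
  moreover have "- Z \<noteq> (\<lambda>_. 0)" using Z_nonzero by (auto simp: fun_eq_iff)
  ultimately have "(- Z) f = (- Y) f"
    using assms ends f zero_on_F Z(2) Z_zero_on_F
    by (intro leaving_hyperplane_aux[OF ext.uminus_covector[OF Z(1)] _ _ _ _ ext.uminus_covector[OF ends(4)]])
      simp_all
  then show ?thesis by simp
qed

section \<open>Elimination at \<open>e\<close> compared with elimination at \<open>p\<close>\<close>

definition "Z\<^sub>0 = cocircuit_elim L e (- (X(p := 0))) (Y(p := 0))"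

context
  assumes nonzero_at_e: "X e \<noteq> 0" "Y e \<noteq> 0"
begin

lemma ends_at_e: "X e = \<alpha>" "Y e = \<alpha>" "e \<notin> F" "e \<noteq> p"
  using end_value_at_e nonzero_at_e notin_F list_subset p_new by auto

lemma Z\<^sub>0: "Z\<^sub>0 \<in> L" "Z\<^sub>0 e = 0" "\<And>h. h \<noteq> p \<Longrightarrow> h \<notin> sep (- X) Y \<Longrightarrow> Z\<^sub>0 h = sv_comp (- X) Y h"
proof -
  let ?X = "X(p := 0)" and ?Y = "Y(p := 0)"
  have "?X e = ?Y e" "?X e \<noteq> 0" using ends_at_e nonzero_at_e by auto
  then have *: "Z\<^sub>0 \<in> L" "Z\<^sub>0 e = 0" "\<And>h. h \<notin> sep (- ?X) ?Y \<Longrightarrow> Z\<^sub>0 h = sv_comp (- ?X) ?Y h"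
    using base.comodular_elim[OF comodular_base, of e] unfolding Z\<^sub>0_def by auto
  show "Z\<^sub>0 \<in> L" "Z\<^sub>0 e = 0" by fact+
  show "Z\<^sub>0 h = sv_comp (- X) Y h" if "h \<noteq> p" "h \<notin> sep (- X) Y" for h
    using *(3)[of h] that by (simp add: sep_def sv_comp_def)
qed

lemma Z\<^sub>0_zero_on_F: "h \<in> F \<Longrightarrow> Z\<^sub>0 h = 0"
  using Z\<^sub>0(3)[of h] zero_on_F[of h] p_new by (auto simp: sep_def sv_comp_def F_def zero_set_def)

lemma common_sign:
  obtains k where "k \<in> E" "k \<noteq> p" "Z k = Z\<^sub>0 k" "Z k \<noteq> 0"
proof -
  obtain k where k: "k \<in> E" "X k \<noteq> Y k" "Z k = sv_comp (- X) Y k" "Z k \<noteq> 0"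
    by (rule nonseparating_element)
  then have "k \<noteq> p" "k \<notin> sep (- X) Y" using p_new by (auto simp: sep_def)
  then show thesis using that k Z\<^sub>0(3) by metis
qed

text \<open>Lifted to \<open>L'\<close>, the cocircuit can be eliminated against
  \<open>Z\<close>.\<close>

definition "Z\<^sub>0' = Z\<^sub>0(p := \<sigma> Z\<^sub>0)"

lemma Z\<^sub>0': "Z\<^sub>0' \<in> L'" "Z\<^sub>0' \<noteq> (\<lambda>_. 0)" "Z\<^sub>0' p = \<sigma> Z\<^sub>0" "\<And>h. h \<noteq> p \<Longrightarrow> Z\<^sub>0' h = Z\<^sub>0 h"
  "\<And>h. h \<in> F \<Longrightarrow> Z\<^sub>0' h = 0" "Z\<^sub>0' e = 0"
proof -
  obtain k where k: "k \<noteq> p" "Z\<^sub>0 k \<noteq> 0" using common_sign by metis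
  then have nz: "Z\<^sub>0 \<noteq> (\<lambda>_. 0)" by auto
  have "Z\<^sub>0 \<in> cocircuits L"
    using ends_at_e list_subset Z\<^sub>0 Z\<^sub>0_zero_on_F nz by (intro base.coline_cocircuit[OF coline_base, of e]) auto
  then show "Z\<^sub>0' \<in> L'" using localization[of Z\<^sub>0] by (simp add: Z\<^sub>0'_def cocircuits_def)
  show eq: "Z\<^sub>0' h = Z\<^sub>0 h" if "h \<noteq> p" for h using that by (simp add: Z\<^sub>0'_def)
  show "Z\<^sub>0' \<noteq> (\<lambda>_. 0)" using eq[OF k(1)] k(2) by auto
  show "Z\<^sub>0' p = \<sigma> Z\<^sub>0" by (simp add: Z\<^sub>0'_def)
  show "Z\<^sub>0' e = 0" using Z\<^sub>0 ends_at_e by (simp add: Z\<^sub>0'_def)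
  show "Z\<^sub>0' h = 0" if "h \<in> F" for h
    using that eq[of h] Z\<^sub>0_zero_on_F p_new by (auto simp: F_def zero_set_def)
qed

lemma sigma_sign: "\<sigma> Z\<^sub>0 = -1 \<or> \<sigma> Z\<^sub>0 = 0 \<or> \<sigma> Z\<^sub>0 = 1"
  using ext.covector_sign[OF Z\<^sub>0'(1), of p] Z\<^sub>0'(3) by simp

lemma Z_eq_of_sigma_zero:
  assumes "\<sigma> Z\<^sub>0 = 0"
  shows "Z = Z\<^sub>0'"
proof -
  obtain k where k: "k \<noteq> p" "Z k = Z\<^sub>0 k" "Z k \<noteq> 0" using common_sign by metis
  have "Z = Z\<^sub>0' \<or> Z = - Z\<^sub>0'"
    using assms Z Z\<^sub>0' Z_nonzero Z_zero_on_F p_new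
    by (intro ext.coline_unique_up_to_sign[OF coline_ext, of p]) (auto simp: F_def zero_set_def)
  moreover have "Z \<noteq> - Z\<^sub>0'" using k Z\<^sub>0'(4)[OF k(1)] by auto
  ultimately show ?thesis by blast
qed

text \<open>Near \<open>Z\<^sub>0\<close> the hyperplane \<open>p\<close> is \<open>\<alpha> e + \<epsilon> s = 0\<close> with \<open>\<epsilon>\<close> infinitesimal and \<open>s = \<sigma> Z\<^sub>0\<close>.\<close>

lemma Z_at_e:
  assumes s: "\<sigma> Z\<^sub>0 \<noteq> 0"
  shows "Z e = - \<alpha> * \<sigma> Z\<^sub>0"
proof (rule ccontr)
  assume ne: "Z e \<noteq> - \<alpha> * \<sigma> Z\<^sub>0"
  obtain k where k: "k \<in> E" "k \<noteq> p" "Z k = Z\<^sub>0 k" "Z k \<noteq> 0" by (rule common_sign)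
  show False
  proof (cases "Z e = 0")
    case True
    have "Z = Z\<^sub>0' \<or> Z = - Z\<^sub>0'"
      using True Z Z\<^sub>0' Z_nonzero Z_zero_on_F ends_at_e list_subset
      by (intro ext.coline_unique_up_to_sign[OF coline_ext, of e]) auto
    then show False using s Z\<^sub>0'(3) Z(2) by auto
  next
    case False
    have Ze: "Z e = \<alpha> * \<sigma> Z\<^sub>0"
      using False ne sign s sigma_sign ext.covector_sign[OF Z(1), of e] by auto
    \<comment> \<open>\<open>U\<close> acts as a difference of \<open>Z\<close> and
      \<open>Z\<^sub>0'\<close>. Its zero at \<open>k\<close> forces
      \<open>U p = \<alpha> * U e\<close>, which the wrong sign of \<open>Z e\<close>
      violates.\<close>
    have "Z k = - (- Z\<^sub>0') k" using k Z\<^sub>0'(4) by simp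
    then obtain U where U: "U \<in> L'" "U k = 0" "\<And>h. h \<notin> sep Z (- Z\<^sub>0') \<Longrightarrow> U h = sv_comp Z (- Z\<^sub>0') h"
      using ext.covector_elimination[OF Z(1) ext.uminus_covector[OF Z\<^sub>0'(1)]] k(4) by metis
    have Up: "U p = - \<sigma> Z\<^sub>0" using U(3)[of p] Z(2) Z\<^sub>0'(3) by (auto simp: sep_def sv_comp_def)
    have Ue: "U e = \<alpha> * \<sigma> Z\<^sub>0" using U(3)[of e] Z\<^sub>0'(6) unfolding Ze[symmetric] by (auto simp: sep_def sv_comp_def)
    have UF: "U h = 0" if "h \<in> F" for h
      using U(3)[of h] Z_zero_on_F[OF that] Z\<^sub>0'(5)[OF that] by (auto simp: sep_def sv_comp_def)
    have kF: "k \<notin> F" using k Z_zero_on_F by auto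
    have "U p = \<alpha> * U e" using s sign Ue by (intro covector_value_at_p_via_e[OF U(1) UF k(1) kF U(2)]) auto
    then show False using Up Ue s sign by auto
  qed
qed

text \<open>If \<open>\<sigma> Z\<^sub>0\<close> is nonzero, a zero of \<open>Z\<close> at
  \<open>f\<close> would force \<open>Z p = \<alpha> * Z e\<close>, which is nonzero. Opposite signs
  at \<open>f\<close> would let the elimination of \<open>f\<close> produce a covector that violates
  the same rule.\<close>

lemma Z_at_f_of_nonzero:
  assumes "Z\<^sub>0 f \<noteq> 0"
  shows "Z f = Z\<^sub>0 f"
proof -
  have fp: "f \<noteq> p" "f \<notin> F" using f p_new notin_F by auto
  show ?thesis
  proof (cases "\<sigma> Z\<^sub>0 = 0")
    case True
    then show ?thesis using Z_eq_of_sigma_zero Z\<^sub>0'(4) fp by simp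
  next
    case s: False
    have Ze: "Z e = - \<alpha> * \<sigma> Z\<^sub>0" "Z e \<noteq> 0" using Z_at_e[OF s] s sign by auto
    show ?thesis
    proof (rule ccontr)
      assume ne: "Z f \<noteq> Z\<^sub>0 f"
      show False
      proof (cases "Z f = 0")
        case True
        then show ?thesis using covector_value_at_p_via_e[OF Z(1) Z_zero_on_F f(1) fp(2)] Ze Z(2) sign by auto
      next
        case False
        have "Z f = - Z\<^sub>0' f"
          using ne assms False Z\<^sub>0'(4)[OF fp(1)] ext.covector_sign[OF Z(1), of f] ext.covector_sign[OF Z\<^sub>0'(1), of f]
          by auto
        then obtain U where U: "U \<in> L'" "U f = 0" "\<And>h. h \<notin> sep Z Z\<^sub>0' \<Longrightarrow> U h = sv_comp Z Z\<^sub>0' h"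
          using ext.covector_elimination[OF Z(1) Z\<^sub>0'(1)] False by metis
        have Up: "U p = \<sigma> Z\<^sub>0" using U(3)[of p] Z(2) Z\<^sub>0'(3) by (auto simp: sep_def sv_comp_def)
        have Ue: "U e = - \<alpha> * \<sigma> Z\<^sub>0" using U(3)[of e] Ze Z\<^sub>0'(6) by (auto simp: sep_def sv_comp_def)
        have UF: "U h = 0" if "h \<in> F" for h
          using U(3)[of h] Z_zero_on_F[OF that] Z\<^sub>0'(5)[OF that] by (auto simp: sep_def sv_comp_def)
        have "U p = \<alpha> * U e"
          using s sign Ue by (intro covector_value_at_p_via_e[OF U(1) UF f(1) fp(2) U(2)]) auto
        then show False using Up Ue s sign by auto
      qed
    qed
  qed
qed

text \<open>\<open>Z\<^sub>0\<close> vanishes at \<open>e\<close> and at \<open>f\<close>, so on the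
  coline the entry at \<open>e\<close> determines the entry at \<open>f\<close>. By its entry at
  \<open>e\<close>, \<open>Z\<close> behaves like \<open>X\<close> scaled by
  \<open>- \<sigma> Z\<^sub>0\<close>.\<close>

lemma Z_at_f_of_zero:
  assumes "Z\<^sub>0 f = 0"
  shows "Z f = - X f * \<sigma> Z\<^sub>0"
proof (cases "\<sigma> Z\<^sub>0 = 0")
  case True
  then show ?thesis using Z_eq_of_sigma_zero Z\<^sub>0'(4)[of f] f p_new assms by (cases "f = p") auto
next
  case s: False
  have fp: "f \<noteq> p" using f p_new by auto
  have *: "e \<in> insert p E - F" "Z\<^sub>0' f = 0" using ends_at_e list_subset Z\<^sub>0'(4)[OF fp] assms by auto
  have par: "X f = W f" if "W \<in> L'" "X e = W e" "\<And>h. h \<in> F \<Longrightarrow> W h = 0" for W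
    by (rule ext.coline_parallel[OF coline_ext *(1) Z\<^sub>0'(1,2,6) *(2) ends(3) that(1,2)
          nonzero_at_e(1) zero_on_F(1) that(3) Z\<^sub>0'(5)])
  consider "\<sigma> Z\<^sub>0 = 1" | "\<sigma> Z\<^sub>0 = -1" using s sigma_sign by auto
  then show ?thesis
  proof cases
    case 1
    then have "X e = (- Z) e" using Z_at_e[OF s] ends_at_e by simp
    then have "X f = (- Z) f"
      by (rule par[OF ext.uminus_covector[OF Z(1)]]) (use Z_zero_on_F in simp)
    then show ?thesis using 1 by simp
  next
    case 2
    then have "X e = Z e" using Z_at_e[OF s] ends_at_e by simp
    then have "X f = Z f" by (rule par[OF Z(1)]) (rule Z_zero_on_F)
    then show ?thesis using 2 by simp
  qed
qed

end

end

section \<open>Closed walks\<close>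

text \<open>Edge directions are left out and the sign \<alpha> at \<open>e\<close> is arbitrary, so
  that walks can be reversed and negated; the program graphs only have vertices with sign 1.\<close>

definition closed_walk :: "'a set \<Rightarrow> 'a sign_vec set \<Rightarrow> 'a \<Rightarrow> int \<Rightarrow> 'a sign_vec list \<Rightarrow> bool" where
  "closed_walk E L e \<alpha> Ps \<longleftrightarrow> Ps \<noteq> [] \<and> last Ps = hd Ps \<and> distinct (butlast Ps) \<and>
     set Ps \<subseteq> {V \<in> cocircuits L. V e = \<alpha>} \<and>
     (\<forall>i. Suc i < length Ps \<longrightarrow> conformal (Ps ! i) (Ps ! Suc i) \<and> comodular E L (Ps ! i) (Ps ! Suc i))"

lemma closed_walkD:
  assumes "closed_walk E L e \<alpha> Ps" "Suc i < length Ps"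
  shows "comodular E L (Ps ! i) (Ps ! Suc i)" "conformal (Ps ! i) (Ps ! Suc i)"
    "(Ps ! i) e = \<alpha>" "(Ps ! Suc i) e = \<alpha>" "Ps ! i \<in> cocircuits L" "Ps ! Suc i \<in> cocircuits L"
proof -
  have "Ps ! i \<in> set Ps" "Ps ! Suc i \<in> set Ps" using assms(2) by simp_all
  then show "comodular E L (Ps ! i) (Ps ! Suc i)" "conformal (Ps ! i) (Ps ! Suc i)"
    "(Ps ! i) e = \<alpha>" "(Ps ! Suc i) e = \<alpha>" "Ps ! i \<in> cocircuits L" "Ps ! Suc i \<in> cocircuits L"
    using assms unfolding closed_walk_def by blast+
qed

lemma uminus_sign_vec_swap: "(X :: 'a sign_vec) = - Y \<longleftrightarrow> Y = - X"
  by (auto simp: fun_eq_iff)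

lemma comodular_commute: "comodular E L X Y \<Longrightarrow> comodular E L Y X"
  unfolding comodular_def modular_pair_def
  by (metis (no_types, opaque_lifting) Un_commute Int_commute add.commute uminus_sign_vec_swap)

lemma conformal_commute: "conformal X Y \<Longrightarrow> conformal Y X"
  unfolding conformal_def sep_def by (auto, metis minus_minus neg_equal_0_iff_equal)

lemma conformal_uminus: "conformal X Y \<Longrightarrow> conformal (- X) (- Y)"
  unfolding conformal_def sep_def by (auto, metis minus_minus neg_equal_0_iff_equal)

lemma closed_walk_rev:
  assumes "closed_walk E L e \<alpha> Ps"
  shows "closed_walk E L e \<alpha> (rev Ps)"
proof -
  have ne: "Ps \<noteq> []" and cl: "last Ps = hd Ps" and d: "distinct (butlast Ps)"
    using assms by (auto simp: closed_walk_def)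
  obtain x xs where Ps: "Ps = x # xs" using ne by (cases Ps) auto
  \<comment> \<open>\<open>butlast (rev Ps)\<close> is \<open>rev xs\<close>, and \<open>xs\<close>
    has the same members as \<open>butlast Ps\<close> because the walk is closed.\<close>
  have "distinct xs"
  proof (cases xs rule: rev_cases)
    case (snoc ys y)
    then show ?thesis using Ps cl d by auto
  qed simp
  then have "distinct (butlast (rev Ps))" using Ps by (simp add: butlast_append)
  moreover have "conformal (rev Ps ! i) (rev Ps ! Suc i) \<and> comodular E L (rev Ps ! i) (rev Ps ! Suc i)"
    if i: "Suc i < length (rev Ps)" for i
  proof -
    let ?j = "length Ps - Suc (Suc i)"
    have j: "Suc ?j < length Ps" "rev Ps ! i = Ps ! Suc ?j" "rev Ps ! Suc i = Ps ! ?j"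
      using i by (auto simp: rev_nth Suc_diff_Suc)
    show ?thesis using closed_walkD[OF assms j(1)] j comodular_commute conformal_commute by metis
  qed
  ultimately show ?thesis using assms by (auto simp: closed_walk_def hd_rev last_rev)
qed

context oriented_matroid_covectors
begin

lemma uminus_cocircuit:
  assumes "X \<in> cocircuits L"
  shows "- X \<in> cocircuits L"
  unfolding cocircuits_def
proof (intro CollectI conjI ballI impI)
  have X: "X \<in> L" "X \<noteq> (\<lambda>_. 0)" using assms by (auto simp: cocircuits_def)
  show "- X \<in> L" using X uminus_covector by blast
  show "- X \<noteq> (\<lambda>_. 0)" using X by (auto simp: fun_eq_iff)
  fix Y assume Y: "Y \<in> L" "Y \<noteq> (\<lambda>_. 0) \<and> face_le Y (- X)"
  have "Y h = 0 \<or> Y h = - X h" for h using Y(2) unfolding face_le_def by (metis uminus_apply)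
  then have "face_le (- Y) X" by (auto simp: face_le_def) (metis minus_minus)
  moreover have "- Y \<noteq> (\<lambda>_. 0)" using Y by (auto simp: fun_eq_iff)
  ultimately have "- Y = X" using assms Y uminus_covector unfolding cocircuits_def by blast
  then show "Y = - X" by (simp add: uminus_sign_vec_swap)
qed

lemma comodular_uminus: "comodular E L X Y \<Longrightarrow> comodular E L (- X) (- Y)"
proof -
  assume *: "comodular E L X Y"
  have "zero_set E (- X) = zero_set E X" "zero_set E (- Y) = zero_set E Y"
    by (auto simp: zero_set_def supp_def)
  moreover have "- X \<noteq> - Y" "- X \<noteq> - (- Y)"
    using * by (auto simp: comodular_def fun_eq_iff) (metis minus_minus)
  ultimately show ?thesis using * uminus_cocircuit by (auto simp: comodular_def)
qed

lemma closed_walk_uminus: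
  assumes "closed_walk E L e \<alpha> Ps"
  shows "closed_walk E L e (- \<alpha>) (map uminus Ps)"
proof -
  have "inj_on (uminus :: 'a sign_vec \<Rightarrow> _) A" for A by (auto simp: inj_on_def fun_eq_iff)
  then have "distinct (butlast (map uminus Ps))"
    using assms by (auto simp: closed_walk_def distinct_map simp flip: map_butlast)
  moreover have "conformal (map uminus Ps ! i) (map uminus Ps ! Suc i) \<and>
      comodular E L (map uminus Ps ! i) (map uminus Ps ! Suc i)"
    if i: "Suc i < length (map uminus Ps)" for i
  proof -
    have "Suc i < length Ps" using i by simp
    then show ?thesis using closed_walkD(1,2)[OF assms, of i] comodular_uminus conformal_uminus by simp
  qed
  moreover have "set (map uminus Ps) \<subseteq> {V \<in> cocircuits L. V e = - \<alpha>}"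
    using assms uminus_cocircuit by (auto simp: closed_walk_def)
  ultimately show ?thesis using assms by (auto simp: closed_walk_def hd_map last_map)
qed

section \<open>Euclideanness applied to closed walks\<close>

lemma euclidean_closed_walk_positive:
  assumes no_cycle: "\<nexists>Ps. directed_cycle E L e f Ps" and walk: "closed_walk E L e 1 Ps"
    and fwd: "\<And>i. Suc i < length Ps \<Longrightarrow> 0 \<le> cocircuit_elim L e (- (Ps ! i)) (Ps ! Suc i) f"
    and i: "Suc i < length Ps"
  shows "cocircuit_elim L e (- (Ps ! i)) (Ps ! Suc i) f = 0"
proof (rule ccontr)
  assume nz: "cocircuit_elim L e (- (Ps ! i)) (Ps ! Suc i) f \<noteq> 0"
  have dir: "edge_fwd L e f (Ps ! j) (Ps ! Suc j) \<or> edge_undirected L e f (Ps ! j) (Ps ! Suc j)"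
    if j: "Suc j < length Ps" for j
  proof -
    have "cocircuit_elim L e (- (Ps ! j)) (Ps ! Suc j) \<in> L"
      using closed_walkD[OF walk j] by (intro comodular_elim(1)) auto
    then show ?thesis using fwd[OF j] covector_sign[of _ f]
      unfolding edge_fwd_def edge_undirected_def by fastforce
  qed
  have adj: "graph_adj E L e (Ps ! j) (Ps ! Suc j)" if "Suc j < length Ps" for j
    using closed_walkD[OF walk that] by (simp add: graph_adj_def graph_verts_def)
  have "\<not> edge_undirected L e f (Ps ! i) (Ps ! Suc i)" using nz by (simp add: edge_undirected_def)
  moreover have "Ps \<noteq> []" "set Ps \<subseteq> graph_verts L e" "last Ps = hd Ps" "distinct (butlast Ps)"
    using walk by (auto simp: closed_walk_def graph_verts_def)
  ultimately have "directed_cycle E L e f Ps"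
    unfolding directed_cycle_def using i dir adj by blast
  then show False using no_cycle by blast
qed

text \<open>For \<open>s = -1\<close> the reversed walk has only nonnegative entries at
  \<open>f\<close>.\<close>

lemma euclidean_closed_walk_oriented:
  assumes no_cycle: "\<nexists>Ps. directed_cycle E L e f Ps" and walk: "closed_walk E L e 1 Ps"
    and s: "s = 1 \<or> s = -1"
    and fwd: "\<And>i. Suc i < length Ps \<Longrightarrow> 0 \<le> s * cocircuit_elim L e (- (Ps ! i)) (Ps ! Suc i) f"
    and i: "Suc i < length Ps"
  shows "cocircuit_elim L e (- (Ps ! i)) (Ps ! Suc i) f = 0"
proof (cases "s = 1")
  case True
  then show ?thesis using euclidean_closed_walk_positive[OF no_cycle walk _ i] fwd by simp
next
  case False
  have rev: "Suc (length Ps - Suc (Suc j)) < length Ps"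
    "rev Ps ! j = Ps ! Suc (length Ps - Suc (Suc j))" "rev Ps ! Suc j = Ps ! (length Ps - Suc (Suc j))"
    if "Suc j < length Ps" for j
    using that by (auto simp: rev_nth Suc_diff_Suc)
  have elim: "cocircuit_elim L e (- (rev Ps ! j)) (rev Ps ! Suc j) f =
      - cocircuit_elim L e (- (Ps ! (length Ps - Suc (Suc j)))) (Ps ! Suc (length Ps - Suc (Suc j))) f"
    if j: "Suc j < length Ps" for j
    using comodular_elim_reverse[of _ _ e] closed_walkD[OF walk rev(1)[OF j]] rev(2,3)[OF j] by simp
  let ?j = "length Ps - Suc (Suc i)"
  have j: "Suc ?j < length Ps" "length Ps - Suc (Suc ?j) = i" using i by auto
  have "cocircuit_elim L e (- (rev Ps ! ?j)) (rev Ps ! Suc ?j) f = 0"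
  proof (rule euclidean_closed_walk_positive[OF no_cycle closed_walk_rev[OF walk]])
    show "0 \<le> cocircuit_elim L e (- (rev Ps ! k)) (rev Ps ! Suc k) f" if "Suc k < length (rev Ps)" for k
      using elim[of k] fwd[OF rev(1)[of k]] that False s by simp
  qed (use j in simp)
  then show ?thesis using elim[OF j(1)] unfolding j(2) by simp
qed

text \<open>If \<open>f = e\<close> or \<open>f\<close> is a coloop, the entry vanishes without any
  program. Otherwise the case of sign -1 at \<open>e\<close> is reduced to sign 1 by negating the
  walk, which turns \<open>s\<close> into \<open>- s\<close>.\<close>

lemma euclidean_closed_walk:
  assumes eucl: "euclidean_om E L" and f: "f \<in> E" and walk: "closed_walk E L e \<alpha> Ps"
    and \<alpha>: "\<alpha> = 1 \<or> \<alpha> = -1" and s: "s = 1 \<or> s = -1"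
    and fwd: "\<And>i. Suc i < length Ps \<Longrightarrow> 0 \<le> s * cocircuit_elim L e (- (Ps ! i)) (Ps ! Suc i) f"
    and i: "Suc i < length Ps"
  shows "cocircuit_elim L e (- (Ps ! i)) (Ps ! Suc i) f = 0"
proof -
  note w = closed_walkD[OF walk]
  have cov: "Ps ! i \<in> L" using w(5)[OF i] by (simp add: cocircuits_def)
  have eE: "e \<in> E" using w(3)[OF i] covector_outside[OF cov, of e] \<alpha> by (cases "e \<in> E") auto
  have elim: "comodular E L (Ps ! j) (Ps ! Suc j)" "(Ps ! j) e = (Ps ! Suc j) e" "(Ps ! j) e \<noteq> 0"
    if "Suc j < length Ps" for j using w[OF that] \<alpha> by auto
  consider "f = e" | "f \<noteq> e" "mat_coloop E L f" | "f \<noteq> e" "\<not> mat_coloop E L f" by blast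
  then show ?thesis
  proof cases
    case 1
    then show ?thesis using comodular_elim(2)[OF elim[OF i]] by simp
  next
    case 2
    have "(Ps ! i) f = 0" "(Ps ! Suc i) f = 0"
      using coloop_vanishes[OF 2(2) w(5)[OF i] _ 2(1)] coloop_vanishes[OF 2(2) w(6)[OF i] _ 2(1)] elim[OF i]
      by auto
    then show ?thesis using comodular_elim(3)[OF elim[OF i], of f] by (simp add: sep_def sv_comp_def)
  next
    case 3
    have "mat_indep E L {e}" using cov eE elim(3)[OF i] by (auto simp: indep_iff)
    then have "om_program E L e f" using 3 f eE om by (auto simp: om_program_def mat_loop_def)
    then have no_cycle: "\<nexists>Ps. directed_cycle E L e f Ps"
      using eucl by (auto simp: euclidean_om_def euclidean_program_def)
    show ?thesis
    proof (cases "\<alpha> = 1")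
      case True
      then show ?thesis using euclidean_closed_walk_oriented[OF no_cycle _ s fwd i] walk by simp
    next
      case False
      let ?Qs = "map uminus Ps"
      have walk': "closed_walk E L e 1 ?Qs" using closed_walk_uminus[OF walk] False \<alpha> by simp
      have neg: "cocircuit_elim L e (- (?Qs ! j)) (?Qs ! Suc j) f =
          - cocircuit_elim L e (- (Ps ! j)) (Ps ! Suc j) f" if j: "Suc j < length Ps" for j
        using comodular_elim_uminus[OF elim[OF j]] j by simp
      have "cocircuit_elim L e (- (?Qs ! i)) (?Qs ! Suc i) f = 0"
      proof (rule euclidean_closed_walk_oriented[OF no_cycle walk'])
        show "- s = 1 \<or> - s = -1" using s by auto
        show "0 \<le> - s * cocircuit_elim L e (- (?Qs ! k)) (?Qs ! Suc k) f" if "Suc k < length ?Qs" for k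
          using neg[of k] fwd[of k] that by simp
      qed (use i in simp)
      then show ?thesis using neg[OF i] by simp
    qed
  qed
qed

end

section \<open>The cycle argument\<close>

lemma cyclic_monotone_constant:
  fixes a :: "nat \<Rightarrow> int"
  assumes step: "\<And>i. Suc i < n \<Longrightarrow> a i \<le> a (Suc i)" and cyc: "a (n - 1) = a 0" and i: "i < n"
  shows "a i = a 0"
proof -
  have up: "a j \<le> a k" if "j \<le> k" "k < n" for j k
    using that by (induction k rule: dec_induct) (auto intro: order_trans step)
  show ?thesis using up[of 0 i] up[of i "n - 1"] cyc i by simp
qed

theorem theorem1p1:
  fixes E :: "'a set" and L L' :: "'a sign_vec set" and I :: "('a \<times> int) list" and p :: 'a
  assumes "euclidean_om E L"
    and "lexicographic_extension E L I p L'"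
  shows "\<forall>f\<in>E. om_program (insert p E) L' p f \<longrightarrow> euclidean_program (insert p E) L' p f"
proof (intro ballI impI)
  fix f assume f: "f \<in> E" and prog: "om_program (insert p E) L' p f"
  have no_cycle: False if cycle: "directed_cycle (insert p E) L' p f Ps" for Ps
  proof -
    have om: "oriented_matroid E L" using assms(1) by (simp add: euclidean_om_def)
    have I: "fst ` set I \<subseteq> E" "snd ` set I \<subseteq> {1, -1}"
      and ext: "oriented_matroid (insert p E) L'" "p \<notin> E" "(\<lambda>X. X(p := 0)) ` L' = L"
      and loc: "\<And>V. V \<in> cocircuits L \<Longrightarrow> V(p := lex_localization I V) \<in> cocircuits L'"
      using assms(2) by (auto simp: lexicographic_extension_def single_element_extension_def)
    interpret base: oriented_matroid_covectors E L by unfold_locales (rule om)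
    interpret ext: oriented_matroid_covectors "insert p E" L' by unfold_locales (rule ext)
    let ?n = "length Ps"
    let ?Z = "\<lambda>i. cocircuit_elim L' p (- (Ps ! i)) (Ps ! Suc i)"
    have ne: "Ps \<noteq> []" and verts: "set Ps \<subseteq> graph_verts L' p" and closed: "last Ps = hd Ps"
      and dist: "distinct (butlast Ps)"
      using cycle by (auto simp: directed_cycle_def)
    have adj: "graph_adj (insert p E) L' p (Ps ! i) (Ps ! Suc i)" and Znonneg: "0 \<le> ?Z i f"
      if "Suc i < ?n" for i
      using cycle that by (auto simp: directed_cycle_def edge_fwd_def edge_undirected_def)
    obtain i0 where i0: "Suc i0 < ?n" "?Z i0 f \<noteq> 0"
      using cycle by (auto simp: directed_cycle_def edge_undirected_def)
    have cyc: "Ps ! (?n - 1) = Ps ! 0" using ne closed by (simp add: last_conv_nth hd_conv_nth)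
    have vert: "Ps ! i \<in> cocircuits L'" "(Ps ! i) p = 1" if "i < ?n" for i
      using verts nth_mem[OF that] by (auto simp: graph_verts_def)
    have com: "comodular (insert p E) L' (Ps ! i) (Ps ! Suc i)" "(Ps ! i) p = (Ps ! Suc i) p"
      "(Ps ! i) p \<noteq> 0" if "Suc i < ?n" for i
      using adj[OF that] by (auto simp: graph_adj_def graph_verts_def)
    define c where "c = (Ps ! 0) f"
    have const: "(Ps ! i) f = c" if "i < ?n" for i
      unfolding c_def
    proof (rule cyclic_monotone_constant[where n = ?n and a = "\<lambda>i. (Ps ! i) f"])
      show "(Ps ! j) f \<le> (Ps ! Suc j) f" if "Suc j < ?n" for j
        using ext.edge_objective_mono[OF com[OF that] Znonneg[OF that]] .
    qed (use cyc that in auto)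
    \<comment> \<open>If both ends of the directed edge \<open>i0\<close> vanished at
      \<open>f\<close>, the cocircuit eliminated there would vanish at \<open>f\<close> too.\<close>
    have "c \<noteq> 0"
    proof
      assume "c = 0"
      then have "(Ps ! i0) f = 0" "(Ps ! Suc i0) f = 0" using const i0 by auto
      then show False using ext.comodular_elim(3)[OF com[OF i0(1)], of f] i0(2)
        by (auto simp: sep_def sv_comp_def)
    qed
    then have c: "c = 1 \<or> c = -1"
      using ext.covector_sign[of "Ps ! 0" f] vert(1)[of 0] ne by (auto simp: c_def cocircuits_def)
    have edge: "extension_edge E L' p L (lex_localization I) (Ps ! i) (Ps ! Suc i) f"
      if "Suc i < ?n" for i
      using om ext loc adj[OF that] f const that \<open>c \<noteq> 0\<close> by unfold_locales auto
    \<comment> \<open>Otherwise the localization would be 0 on the restricted vertices, although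
      their entry 1 at \<open>p\<close> makes it 1.\<close>
    have "\<exists>x\<in>set I. \<exists>V\<in>set Ps. V (fst x) \<noteq> 0"
    proof (rule ccontr)
      assume none: "\<not> ?thesis"
      have "((Ps ! i0)(p := 0)) d = 0" if "d \<in> fst ` set I" for d
        using none that i0 nth_mem[of i0 Ps] by fastforce
      then have "lex_localization I ((Ps ! i0)(p := 0)) = 0" by (rule lex_localization_eq_zero)
      moreover have "lex_localization I ((Ps ! i0)(p := 0)) = 1"
        using extension_edge.sigma_end[OF edge[OF i0(1)]] vert[of i0] const[of i0] i0 \<open>c \<noteq> 0\<close> by auto
      ultimately show False by simp
    qed
    from split_list_first_prop[OF this] obtain I1 x J
      where split: "I = I1 @ x # J" and x: "\<exists>V\<in>set Ps. V (fst x) \<noteq> 0"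
      and I1: "\<forall>y\<in>set I1. \<not> (\<exists>V\<in>set Ps. V (fst y) \<noteq> 0)"
      by blast
    obtain e \<alpha> where xe: "x = (e, \<alpha>)" by (cases x)
    have \<alpha>: "\<alpha> = 1 \<or> \<alpha> = -1" and eE: "e \<in> E" using I split xe by auto
    have I1': "(Ps ! i) d = 0" if "i < ?n" "d \<in> fst ` set I1" for i d
      using I1 that nth_mem[OF that(1)] by fastforce
    have lex_edge: "lexicographic_edge E L' p L I1 J e \<alpha> (Ps ! i) (Ps ! Suc i) f" if "Suc i < ?n" for i
    proof -
      interpret extension_edge E L' p L "lex_localization (I1 @ (e, \<alpha>) # J)" "Ps ! i" "Ps ! Suc i" f
        using edge[OF that] split xe by simp
      show ?thesis using I split xe \<alpha> eE I1' that by unfold_locales auto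
    qed
    note Z_def = lexicographic_edge.axioms(1)[OF lex_edge, THEN extension_edge.Z_def]
    \<comment> \<open>Where \<open>e\<close> changes from zero to nonzero, \<open>?Z i f\<close> is
      \<open>- c\<close>; where it changes back, it is \<open>c\<close>. As these entries are
      nonnegative, \<open>b\<close> never decreases, so around the cycle it is constant.\<close>
    define b where "b i = - c * (if (Ps ! i) e = 0 then 0 else 1)" for i
    have b: "b i = b 0" if "i < ?n" for i
    proof (rule cyclic_monotone_constant[where n = ?n])
      fix j assume j: "Suc j < ?n"
      show "b j \<le> b (Suc j)"
        using lexicographic_edge.leaving_hyperplane[OF lex_edge[OF j]]
          lexicographic_edge.entering_hyperplane[OF lex_edge[OF j]]
          Znonneg[OF j] const[of j] const[of "Suc j"] j c unfolding Z_def[OF j] b_def by auto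
    qed (use cyc that in \<open>auto simp: b_def\<close>)
    have nz: "(Ps ! i) e \<noteq> 0" if "i < ?n" for i
    proof -
      obtain k where "k < ?n" "(Ps ! k) e \<noteq> 0" using x xe by (auto simp: in_set_conv_nth)
      then show ?thesis using b[OF that] b[of k] \<open>c \<noteq> 0\<close> by (auto simp: b_def split: if_splits)
    qed
    have at_e: "(Ps ! i) e = \<alpha>" if "i < ?n" for i
    proof (cases "Suc i < ?n")
      case True
      then show ?thesis using lexicographic_edge.end_value_at_e[OF lex_edge[OF True]] nz that by blast
    next
      case False
      \<comment> \<open>The last vertex starts no edge, but it repeats the first one.\<close>
      then have "Ps ! i = Ps ! 0" using cyc that by (metis Suc_lessI diff_Suc_1)
      moreover have "Suc 0 < ?n" using i0 by simp
      ultimately show ?thesis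
        using lexicographic_edge.end_value_at_e[OF lex_edge[of 0]] nz that by metis
    qed
    define Qs where "Qs = map (\<lambda>V. V(p := 0)) Ps"
    have Qs: "length Qs = ?n" "\<And>i. i < ?n \<Longrightarrow> Qs ! i = (Ps ! i)(p := 0)" by (auto simp: Qs_def)
    have ep: "e \<noteq> p" using eE ext by auto
    have walk: "closed_walk E L e \<alpha> Qs"
      unfolding closed_walk_def
    proof (intro conjI allI impI)
      show "Qs \<noteq> []" "last Qs = hd Qs" using ne closed by (auto simp: Qs_def last_map hd_map)
      have "inj_on (\<lambda>V. V(p := 0)) (set Ps)"
      proof (rule inj_onI)
        fix V W assume VW: "V \<in> set Ps" "W \<in> set Ps" and eq: "V(p := 0) = W(p := 0)"
        have "V p = 1" "W p = 1" using verts VW unfolding graph_verts_def by blast+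
        then show "V = W" using eq by (metis fun_upd_triv fun_upd_upd)
      qed
      then have "inj_on (\<lambda>V. V(p := 0)) (set (butlast Ps))" by (rule inj_on_subset) (auto dest: in_set_butlastD)
      then show "distinct (butlast Qs)" using dist by (simp add: Qs_def distinct_map flip: map_butlast)
      show "set Qs \<subseteq> {V \<in> cocircuits L. V e = \<alpha>}"
      proof
        fix V assume "V \<in> set Qs"
        then obtain k where k: "k < ?n" "V = (Ps ! k)(p := 0)" using Qs by (auto simp: in_set_conv_nth)
        have "V \<in> cocircuits L"
          using extension_edge.end_restrict[OF edge[OF i0(1)] vert[OF k(1)]] const[OF k(1)] \<open>c \<noteq> 0\<close> k by simp
        then show "V \<in> {V \<in> cocircuits L. V e = \<alpha>}" using at_e[OF k(1)] k ep by simp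
      qed
      fix i assume "Suc i < length Qs"
      then have i: "Suc i < ?n" by (simp add: Qs)
      then show "conformal (Qs ! i) (Qs ! Suc i)" "comodular E L (Qs ! i) (Qs ! Suc i)"
        using extension_edge.conformal_base[OF edge[OF i]] extension_edge.comodular_base[OF edge[OF i]]
          Qs(2)[of i] Qs(2)[of "Suc i"] by simp_all
    qed
    define Z0 where "Z0 i = cocircuit_elim L e (- (Qs ! i)) (Qs ! Suc i)" for i
    have Z0_def': "lexicographic_edge.Z\<^sub>0 p L e (Ps ! i) (Ps ! Suc i) = Z0 i" if "Suc i < ?n" for i
      using lexicographic_edge.Z\<^sub>0_def[OF lex_edge[OF that]] Qs(2)[of i] Qs(2)[of "Suc i"] that
      by (simp add: Z0_def)
    have Z0_vanish: "Z0 i d = 0"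
      if "d \<in> E" "s = 1 \<or> s = -1" "\<And>j. Suc j < ?n \<Longrightarrow> 0 \<le> s * Z0 j d" "Suc i < ?n" for i d s
      using base.euclidean_closed_walk[OF assms(1) that(1) walk \<alpha> that(2), of i] that(3,4)
      by (simp add: Z0_def Qs)
    have Zf_nonzero: "?Z i f = Z0 i f" if "Suc i < ?n" "Z0 i f \<noteq> 0" for i
      using lexicographic_edge.Z_at_f_of_nonzero[OF lex_edge[OF that(1)] nz nz] that
      unfolding Z_def[OF that(1)] Z0_def'[OF that(1)] by simp
    \<comment> \<open>A nonzero \<open>Z0 j f\<close> equals \<open>?Z j f\<close>, so no edge of
      the walk has a negative entry at \<open>f\<close> and Euclideanness applies with
      \<open>s = 1\<close>.\<close>
    have Z0f: "Z0 i f = 0" if "Suc i < ?n" for i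
    proof (rule Z0_vanish[where s = 1])
      show "0 \<le> 1 * Z0 j f" if "Suc j < ?n" for j
        using Zf_nonzero[OF that] Znonneg[OF that] by (cases "Z0 j f = 0") auto
    qed (use f that in auto)
    have Zf: "?Z i f = - c * lex_localization I (Z0 i)" if "Suc i < ?n" for i
      using lexicographic_edge.Z_at_f_of_zero[OF lex_edge[OF that] nz nz] that Z0f[OF that] const[of i]
      unfolding Z_def[OF that] Z0_def'[OF that] by (simp add: split xe)
    have Z0I: "Z0 i d = 0" if "Suc i < ?n" "d \<in> insert e (fst ` set I1)" for i d
    proof -
      note w = closed_walkD[OF walk, unfolded Qs(1), OF that(1)]
      have el: "comodular E L (Qs ! i) (Qs ! Suc i)" "(Qs ! i) e = (Qs ! Suc i) e" "(Qs ! i) e \<noteq> 0"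
        using w \<alpha> by auto
      show ?thesis
      proof (cases "d = e")
        case True
        then show ?thesis using base.comodular_elim(2)[OF el] by (simp add: Z0_def)
      next
        case False
        then have "(Qs ! i) d = 0" "(Qs ! Suc i) d = 0" using that I1' Qs(2) by auto
        then show ?thesis using base.comodular_elim(3)[OF el, of d]
          by (simp add: Z0_def sep_def sv_comp_def)
      qed
    qed
    \<comment> \<open>Induction over the prefixes of \<open>J\<close>. Once all earlier list
      elements vanish on every \<open>Z0 j\<close>, the next element \<open>d\<close> decides the
      localization where it is nonzero. There \<open>?Z j f\<close> equals
      \<open>- c * \<beta> * Z0 j d\<close>, so the nonnegativity of \<open>?Z j f\<close> is the
      sign condition on \<open>d\<close> with \<open>s = - c * \<beta>\<close>.\<close>
    have J: "\<forall>d\<in>fst ` set J1. \<forall>i. Suc i < ?n \<longrightarrow> Z0 i d = 0" if "\<exists>J2. J = J1 @ J2" for J1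
      using that
    proof (induction J1 rule: rev_induct)
      case (snoc y J1)
      then obtain J2 where J2: "J = J1 @ y # J2" by auto
      obtain d \<beta> where y: "y = (d, \<beta>)" by (cases y)
      have IH: "\<forall>d\<in>fst ` set J1. \<forall>i. Suc i < ?n \<longrightarrow> Z0 i d = 0" using snoc.IH J2 by auto
      have \<beta>: "\<beta> = 1 \<or> \<beta> = -1" and dE: "d \<in> E" using I split J2 y by auto
      have I_eq: "I = (I1 @ (e, \<alpha>) # J1) @ (d, \<beta>) # J2" using split xe J2 y by simp
      have lex: "lex_localization I (Z0 j) = \<beta> * Z0 j d" if j: "Suc j < ?n" "Z0 j d \<noteq> 0" for j
        unfolding I_eq
      proof (rule lex_localization_first_nonzero)
        show "Z0 j d' = 0" if "d' \<in> fst ` set (I1 @ (e, \<alpha>) # J1)" for d'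
          using that Z0I[OF j(1)] IH j(1) by auto
      qed (rule j(2))
      have "Z0 i d = 0" if "Suc i < ?n" for i
      proof (rule Z0_vanish[where s = "- c * \<beta>"])
        show "- c * \<beta> = 1 \<or> - c * \<beta> = -1" using c \<beta> by auto
        show "0 \<le> - c * \<beta> * Z0 j d" if "Suc j < ?n" for j
          using lex[OF that] Zf[OF that] Znonneg[OF that] by (cases "Z0 j d = 0") (auto simp: mult.assoc)
      qed (use dE that in auto)
      then show ?case using IH y by auto
    qed simp
    \<comment> \<open>This makes \<open>?Z i0 f\<close> zero, although \<open>i0\<close> was chosen
      as an edge that is not undirected.\<close>
    have "lex_localization I (Z0 i0) = 0"
    proof (rule lex_localization_eq_zero)
      fix d assume "d \<in> fst ` set I"
      then have "d \<in> insert e (fst ` set I1) \<or> d \<in> fst ` set J" using split xe by auto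
      then show "Z0 i0 d = 0" using Z0I[OF i0(1)] J[of J] i0(1) by auto
    qed
    then show False using Zf[OF i0(1)] i0(2) by simp
  qed
  then show "euclidean_program (insert p E) L' p f" using prog by (auto simp: euclidean_program_def)
qed

end
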